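(* Let $n\ge0$ (with $n\le p-1$ if $\operatorname{char}(K)=p>0$), $f\in C^n(R,K)$, $a\in R$, $c\in K$ and $\delta,\varepsilon>0$. Suppose that $\left|\psi_{n-j}D_jf(r,r_-)-\binom{n+1}{j}c\right|<\varepsilon$ for every $0\le j\le n$ and every $r\in\mathcal{R}_+$ with $|r-a|<\delta$ and $|r_--a|<\delta$. Then $|\psi_{n,j}f(x,y)-c|<\varepsilon$ for every $1\le j\le n+1$ and all distinct $x,y\in R$ with $|x-a|<\delta$ and $|y-a|<\delta$.
   Context: $K$ is a local field: the fraction field of a complete discrete valuation ring $R$ with finite residue field $\kappa$ of cardinality $q$. Fix a uniformizer $\pi$, $|\pi|=q^{-1}$, and a set $\mathcal{T}\subset R$ of representatives of $\kappa$ containing $0$; every $x\in R$ has a unique expansion $\sum_{i\ge0}a_i\pi^i$, $a_i\in\mathcal{T}$. Let $\mathcal{R}_m=\{\sum_{i=0}^{m-1}a_i\pi^i: a_i\in\mathcal{T}\}$ ($m\ge1$), $\mathcal{R}_+=\bigcup_{m\ge1}\mathcal{R}_m$. For $r\in\mathcal{R}_+$ written $r=\sum_{i=0}^{m}a_i\pi^i$, $a_m\neq0$, put $r_-=\sum_{i=0}^{m-1}a_i\pi^i$. Difference quotients: $\nabla^kR=\{(x_1,\dots,x_k)\in R^k$ pairwise distinct$\}$; $\Phi_0f=f$, $\Phi_kf(x_1,\dots,x_{k+1})=\frac{\Phi_{k-1}f(x_1,x_3,\dots,x_{k+1})-\Phi_{k-1}f(x_2,x_3,\dots,x_{k+1})}{x_1-x_2}$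 on $\nabla^{k+1}R$ (a symmetric function). $f$ is $C^k$ if $\Phi_kf$ extends continuously to $R^{k+1}$; $C^k(R,K)$ the set of such. If $f\in C^k$, then $\Phi_{k+1}f$ extends continuously to $R^{k+2}\setminus\Delta_{k+2}$, where $\Delta_{k+2}=\{(x,\dots,x)\}$ is the diagonal. For $f\in C^k$ and $j\le k$, $D_jf(x)=\Phi_jf(x,\dots,x)$, and $D_jf\in C^{k-j}$. For $f\in C^k$ and $0\le j\le k$, $\psi_jf:\nabla^2R\to K$ is $\psi_0f=\Phi_1f$, $\psi_jf(x,y)=\frac{f(x)-f(y)-\sum_{l=1}^j(x-y)^lD_lf(y)}{(x-y)^{j+1}}$. For $f\in C^n$ and $1\le j\le n+1$, $\psi_{n,j}f(x,y)=\Phi_{n+1}f(x,\dots,x,y,\dots,y)$ for distinct $x,y$, with $x$ repeated $j$ times and $y$ repeated $n+2-j$ times. *)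

theory Defs
  imports "HOL-Analysis.Analysis"
begin

section \<open>Local fields\<close>

text \<open>
  A discrete valuation ring is the ring \<open>{x. x = 0 \<or> 0 \<le> v x}\<close> of a normalized (surjective)
  discrete valuation \<open>v\<close> on its fraction field.  The value \<open>v 0\<close>, which should be \<open>\<infinity>\<close>, is
  left unspecified, so every definition below treats \<open>0\<close> separately.
\<close>

locale discrete_valuation =
  fixes v :: "'a::field \<Rightarrow> int"
  assumes v_surj: "\<exists>x. x \<noteq> 0 \<and> v x = k"
    and v_mult: "x \<noteq> 0 \<Longrightarrow> y \<noteq> 0 \<Longrightarrow> v (x * y) = v x + v y"
    and v_add: "x \<noteq> 0 \<Longrightarrow> y \<noteq> 0 \<Longrightarrow> x + y \<noteq> 0 \<Longrightarrow> min (v x) (v y) \<le> v (x + y)"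

definition val_ring :: "('a::field \<Rightarrow> int) \<Rightarrow> 'a set" where
  "val_ring v = {x. x = 0 \<or> 0 \<le> v x}"

definition max_ideal :: "('a::field \<Rightarrow> int) \<Rightarrow> 'a set" where
  "max_ideal v = {x. x = 0 \<or> 0 < v x}"

definition residue_field :: "('a::field \<Rightarrow> int) \<Rightarrow> 'a set set" where
  "residue_field v =
     val_ring v // {(x, y). x \<in> val_ring v \<and> y \<in> val_ring v \<and> x - y \<in> max_ideal v}"

text \<open>The absolute value with \<open>|\<pi>| = 1/q\<close>, where \<open>q\<close> is the cardinality of the residue field.\<close>

definition absv :: "('a::field \<Rightarrow> int) \<Rightarrow> 'a \<Rightarrow> real" where
  "absv v x = (if x = 0 then 0 else real (card (residue_field v)) powi (- v x))"

text \<open>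
  The metric of the type is required to be the one given by the absolute value, so that
  \<open>complete\<close>, \<open>continuous_on\<close> and product topologies refer to the valuation topology.
\<close>

locale local_field = discrete_valuation v for v :: "'a::{field, metric_space} \<Rightarrow> int" +
  assumes finite_residue_field: "finite (residue_field v)"
    and dist_eq_absv: "dist x y = absv v (x - y)"
    and complete_val_ring: "complete (val_ring v)"

definition uniformizer :: "('a::field \<Rightarrow> int) \<Rightarrow> 'a \<Rightarrow> bool" where
  "uniformizer v \<pi> \<longleftrightarrow> \<pi> \<noteq> 0 \<and> v \<pi> = 1"

definition residue_representatives :: "('a::field \<Rightarrow> int) \<Rightarrow> 'a set \<Rightarrow> bool" where
  "residue_representatives v T \<longleftrightarrow>
     T \<subseteq> val_ring v \<and> (\<forall>X\<in>residue_field v. \<exists>!t. t \<in> T \<and> t \<in> X)"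


section \<open>Finite expansions\<close>

definition finite_expansions :: "'a::field \<Rightarrow> 'a set \<Rightarrow> nat \<Rightarrow> 'a set" where
  "finite_expansions \<pi> T m = {\<Sum>i<m. a i * \<pi> ^ i | a. \<forall>i<m. a i \<in> T}"

definition all_finite_expansions :: "'a::field \<Rightarrow> 'a set \<Rightarrow> 'a set" where
  "all_finite_expansions \<pi> T = (\<Union>m\<in>{1..}. finite_expansions \<pi> T m)"

text \<open>
  The element \<open>r\<^sub>-\<close>: the leading term of the expansion of \<open>r\<close> is dropped.  This is
  meaningful only for \<open>r \<noteq> 0\<close>, since \<open>0\<close> has no expansion with nonzero leading digit.
\<close>

definition drop_leading :: "'a::field \<Rightarrow> 'a set \<Rightarrow> 'a \<Rightarrow> 'a" where
  "drop_leading \<pi> T r =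
     (THE s. \<exists>m a. (\<forall>i\<le>m. a i \<in> T) \<and> a m \<noteq> 0 \<and>
        r = (\<Sum>i\<le>m. a i * \<pi> ^ i) \<and> s = (\<Sum>i<m. a i * \<pi> ^ i))"


section \<open>Difference quotients\<close>

text \<open>
  \<open>diff_quot f [x\<^sub>1, \<dots>, x\<^sub>k\<^sub>+\<^sub>1]\<close> is \<open>\<Phi>\<^sub>k f(x\<^sub>1, \<dots>, x\<^sub>k\<^sub>+\<^sub>1)\<close>; the order \<open>k\<close> is
  determined by the length of the list.
\<close>

fun diff_quot :: "('a::field \<Rightarrow> 'a) \<Rightarrow> 'a list \<Rightarrow> 'a" where
  "diff_quot f [] = 0"
| "diff_quot f [x] = f x"
| "diff_quot f (x # y # zs) = (diff_quot f (x # zs) - diff_quot f (y # zs)) / (x - y)"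

text \<open>
  For topological purposes a \<open>k\<close>-tuple over \<open>R\<close> is an extensional function on \<open>{..<k}\<close>; the
  topology on \<open>tuples v k\<close> is the subspace topology of the product topology on \<open>nat \<Rightarrow> 'a\<close>.
\<close>

definition tuples :: "('a::field \<Rightarrow> int) \<Rightarrow> nat \<Rightarrow> (nat \<Rightarrow> 'a) set" where
  "tuples v k = (\<Pi>\<^sub>E i\<in>{..<k}. val_ring v)"

definition distinct_tuples :: "('a::field \<Rightarrow> int) \<Rightarrow> nat \<Rightarrow> (nat \<Rightarrow> 'a) set" where
  "distinct_tuples v k = {x \<in> tuples v k. inj_on x {..<k}}"

definition diagonal :: "('a::field \<Rightarrow> int) \<Rightarrow> nat \<Rightarrow> (nat \<Rightarrow> 'a) set" where
  "diagonal v k = {\<lambda>i\<in>{..<k}. x | x. x \<in> val_ring v}"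

definition Phi :: "nat \<Rightarrow> ('a::field \<Rightarrow> 'a) \<Rightarrow> (nat \<Rightarrow> 'a) \<Rightarrow> 'a" where
  "Phi k f x = diff_quot f (map x [0..<Suc k])"

definition extends_Phi ::
  "('a::{field, metric_space} \<Rightarrow> int) \<Rightarrow> nat \<Rightarrow> ('a \<Rightarrow> 'a) \<Rightarrow> (nat \<Rightarrow> 'a) set
     \<Rightarrow> ((nat \<Rightarrow> 'a) \<Rightarrow> 'a) \<Rightarrow> bool" where
  "extends_Phi v k f S g \<longleftrightarrow>
     continuous_on S g \<and> (\<forall>x\<in>distinct_tuples v (Suc k). g x = Phi k f x)"

text \<open>
  Functions \<open>R \<rightarrow> K\<close> are represented by functions \<open>'a \<Rightarrow> 'a\<close>, of which only the values on
  \<open>val_ring v\<close> matter.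
\<close>

definition C_k :: "('a::{field, metric_space} \<Rightarrow> int) \<Rightarrow> nat \<Rightarrow> ('a \<Rightarrow> 'a) set" where
  "C_k v k = {f. \<exists>g. extends_Phi v k f (tuples v (Suc k)) g}"

text \<open>
  The continuous extension of \<open>\<Phi>\<^sub>k f\<close> to a set \<open>S\<close> with
  \<open>distinct_tuples v (Suc k) \<subseteq> S \<subseteq> tuples v (Suc k)\<close>.  Where it exists, its values on \<open>S\<close> are
  unique, because the tuples with distinct entries are dense in \<open>tuples v (Suc k)\<close>.
\<close>

definition Phi_ext ::
  "('a::{field, metric_space} \<Rightarrow> int) \<Rightarrow> nat \<Rightarrow> ('a \<Rightarrow> 'a) \<Rightarrow> (nat \<Rightarrow> 'a) set
     \<Rightarrow> (nat \<Rightarrow> 'a) \<Rightarrow> 'a" where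
  "Phi_ext v k f S = (SOME g. extends_Phi v k f S g)"

definition D ::
  "('a::{field, metric_space} \<Rightarrow> int) \<Rightarrow> nat \<Rightarrow> ('a \<Rightarrow> 'a) \<Rightarrow> 'a \<Rightarrow> 'a" where
  "D v j f x = Phi_ext v j f (tuples v (Suc j)) (\<lambda>i\<in>{..<Suc j}. x)"

definition psi ::
  "('a::{field, metric_space} \<Rightarrow> int) \<Rightarrow> nat \<Rightarrow> ('a \<Rightarrow> 'a) \<Rightarrow> 'a \<Rightarrow> 'a \<Rightarrow> 'a" where
  "psi v j f x y =
     (if j = 0 then diff_quot f [x, y]
      else (f x - f y - (\<Sum>l=1..j. (x - y) ^ l * D v l f y)) / (x - y) ^ (j + 1))"

text \<open>\<open>\<psi>\<^sub>n\<^sub>,\<^sub>j\<close>, via the extension of \<open>\<Phi>\<^sub>n\<^sub>+\<^sub>1 f\<close> to the complement of the diagonal in \<open>R\<^sup>n\<^sup>+\<^sup>2\<close>.\<close>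

definition psi2 ::
  "('a::{field, metric_space} \<Rightarrow> int) \<Rightarrow> nat \<Rightarrow> nat \<Rightarrow> ('a \<Rightarrow> 'a) \<Rightarrow> 'a \<Rightarrow> 'a \<Rightarrow> 'a" where
  "psi2 v n j f x y =
     Phi_ext v (n + 1) f (tuples v (n + 2) - diagonal v (n + 2))
       (\<lambda>i\<in>{..<n + 2}. if i < j then x else y)"

end

theory Submission
  imports Defs
begin

text \<open>
  Put \<open>d\<^sub>l = D\<^sub>l f\<close> for \<open>l \<le> n\<close> and let \<open>d\<^sub>n\<^sub>+\<^sub>1\<close> be the constant \<open>c\<close>.  Because
  \<open>D\<^sub>l D\<^sub>j f\<close> is \<open>D\<^sub>l\<^sub>+\<^sub>j f\<close> times a binomial coefficient, the hypothesis says that the formal Taylor polynomials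
  of degree \<open>n + 1\<close> with coefficients \<open>d\<^sub>l\<close> at \<open>r\<close> and at \<open>r\<^sub>-\<close> are close: at scale
  \<open>\<rho> = |r - r\<^sub>-|\<close>, the \<open>j\<close>-th coefficients differ by less than \<open>\<epsilon> \<rho>\<^sup>n\<^sup>+\<^sup>1\<^sup>-\<^sup>j\<close>.
  In an ultrametric field this closeness is, at every scale \<open>\<rho>\<close>, an equivalence relation on balls
  of radius \<open>\<rho>\<close>.  Dropping leading digits one at a time until two finite expansions agree
  therefore gives closeness for all pairs of finite expansions in the ball, and
  by continuity of the \<open>D\<^sub>l f\<close> for all pairs \<open>x, y\<close>.  Finally, the divided difference of \<open>f\<close>
  at copies of \<open>x\<close> and \<open>y\<close> minus that of the Taylor polynomial at \<open>y\<close> (which equals \<open>c\<close> at order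
  \<open>n + 1\<close>) is computed from the Taylor remainders by the recursion of divided
  differences, with integer coefficients, so it inherits the bound.
\<close>

section \<open>Continuous extension from a dense subset\<close>

lemma tendsto_fun_componentwise:
  fixes l :: "'i \<Rightarrow> 'b::topological_space"
  assumes "\<And>i. ((\<lambda>p. X p i) \<longlongrightarrow> l i) F"
  shows "(X \<longlongrightarrow> l) F"
proof -
  have "limitin (product_topology (\<lambda>i. euclidean) UNIV) X l F"
    using assms by (simp add: limitin_componentwise)
  then show ?thesis
    by (simp add: euclidean_product_topology)
qed

lemma tendsto_fun_component:
  fixes l :: "'i \<Rightarrow> 'b::topological_space"
  assumes "(X \<longlongrightarrow> l) F"
  shows "((\<lambda>p. X p i) \<longlongrightarrow> l i) F"
  using continuous_on_tendsto_compose[OF continuous_on_product_coordinates[of i] assms] by simp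

text \<open>Take \<open>g z\<close> to be the limit of \<open>\<phi>\<close> at \<open>z\<close>
  along \<open>A\<close>. An open \<open>U\<close> on which \<open>\<phi>\<close> stays within
  \<open>e / 2\<close> of \<open>g z\<close> is also a neighbourhood of each of its points
  \<open>w\<close>, so \<open>g w\<close>, itself a limit of such values, is within
  \<open>e / 2\<close> of \<open>g z\<close>.\<close>

lemma continuous_extension_by_limits:
  fixes \<phi> :: "'b::topological_space \<Rightarrow> 'c::metric_space"
  assumes "A \<subseteq> S"
    and dense: "\<And>z. z \<in> S \<Longrightarrow> inf (nhds z) (principal A) \<noteq> bot"
    and lim: "\<And>z. z \<in> S \<Longrightarrow> \<exists>l. (\<phi> \<longlongrightarrow> l) (inf (nhds z) (principal A))"
  obtains g where "continuous_on S g" and "\<And>x. x \<in> A \<Longrightarrow> g x = \<phi> x"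
proof -
  obtain g where g: "\<And>z. z \<in> S \<Longrightarrow> (\<phi> \<longlongrightarrow> g z) (inf (nhds z) (principal A))"
    using lim by metis
  have "continuous_on S g"
    unfolding continuous_on_def
  proof
    fix z assume z: "z \<in> S"
    show "(g \<longlongrightarrow> g z) (at z within S)"
      unfolding tendsto_iff
    proof (intro allI impI)
      fix e :: real assume e: "e > 0"
      have "eventually (\<lambda>x. dist (\<phi> x) (g z) < e / 2) (inf (nhds z) (principal A))"
        using tendstoD[OF g[OF z], of "e / 2"] e by simp
      then have "eventually (\<lambda>x. x \<in> A \<longrightarrow> dist (\<phi> x) (g z) < e / 2) (nhds z)"
        by (simp add: eventually_inf_principal)
      then obtain U where U: "open U" "z \<in> U"
        and *: "\<And>x. x \<in> U \<Longrightarrow> x \<in> A \<Longrightarrow> dist (\<phi> x) (g z) < e / 2"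
        by (auto simp: eventually_nhds)
      have "dist (g w) (g z) < e" if w: "w \<in> U" "w \<in> S" for w
      proof -
        have "eventually (\<lambda>x. dist (\<phi> x) (g z) \<le> e / 2) (inf (nhds w) (principal A))"
          unfolding eventually_inf_principal eventually_nhds
          using U w * by (intro exI[of _ U]) (auto intro: less_imp_le)
        then have "dist (g w) (g z) \<le> e / 2"
          using dense[OF w(2)] g[OF w(2)]
          by (intro tendsto_le[of "inf (nhds w) (principal A)" "\<lambda>_. e / 2" _ "\<lambda>x. dist (\<phi> x) (g z)"])
            (auto intro!: tendsto_intros)
        then show ?thesis using e by simp
      qed
      then show "eventually (\<lambda>w. dist (g w) (g z) < e) (at z within S)"
        unfolding eventually_at_topological using U by blast
    qed
  qed
  \<comment> \<open>The filter \<open>inf (nhds x) (principal A)\<close> sees the point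
    \<open>x\<close> itself, so a limit along it can only be \<open>\<phi> x\<close>.\<close>
  moreover have "g x = \<phi> x" if x: "x \<in> A" for x
  proof (rule ccontr)
    assume "g x \<noteq> \<phi> x"
    then have "dist (\<phi> x) (g x) > 0" by simp
    then have "eventually (\<lambda>y. dist (\<phi> y) (g x) < dist (\<phi> x) (g x)) (inf (nhds x) (principal A))"
      using tendstoD[OF g] x assms(1) by blast
    then have "eventually (\<lambda>y. y \<in> A \<longrightarrow> dist (\<phi> y) (g x) < dist (\<phi> x) (g x)) (nhds x)"
      by (simp add: eventually_inf_principal)
    then show False
      using x by (auto dest: eventually_nhds_x_imp_x)
  qed
  ultimately show thesis by (rule that)
qed

section \<open>Symmetry of difference quotients\<close>

text \<open>The recursion singles out the first two entries; this Lagrange-type sum treats all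
  entries alike and so exhibits the symmetry of difference quotients.\<close>

lemma diff_quot_eq_sum:
  assumes "distinct xs"
  shows "diff_quot f xs = (\<Sum>x\<in>set xs. f x / (\<Prod>y\<in>set xs - {x}. x - y))"
  using assms
proof (induction f xs rule: diff_quot.induct)
  case (3 f x y zs)
  let ?A = "set zs"
  have xA: "x \<notin> ?A" and yA: "y \<notin> ?A" and xy: "x \<noteq> y" using "3.prems" by auto
  have split: "(\<Sum>w\<in>insert u ?A. f w / (\<Prod>t\<in>insert u ?A - {w}. w - t)) =
     f u / (\<Prod>t\<in>?A. u - t) + (\<Sum>w\<in>?A. f w / ((w - u) * (\<Prod>t\<in>?A - {w}. w - t)))"
    if "u \<notin> ?A" for u
  proof -
    have "(\<Prod>t\<in>insert u ?A - {w}. w - t) = (w - u) * (\<Prod>t\<in>?A - {w}. w - t)" if "w \<in> ?A" for w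
    proof -
      have "insert u ?A - {w} = insert u (?A - {w})" using that \<open>u \<notin> ?A\<close> by auto
      then show ?thesis using \<open>u \<notin> ?A\<close> by simp
    qed
    then show ?thesis using that by simp
  qed
  have x: "diff_quot f (x # zs) =
      f x / (\<Prod>t\<in>?A. x - t) + (\<Sum>w\<in>?A. f w / ((w - x) * (\<Prod>t\<in>?A - {w}. w - t)))"
    using "3.IH"(1) "3.prems" split[OF xA] by simp
  have y: "diff_quot f (y # zs) =
      f y / (\<Prod>t\<in>?A. y - t) + (\<Sum>w\<in>?A. f w / ((w - y) * (\<Prod>t\<in>?A - {w}. w - t)))"
    using "3.IH"(2) "3.prems" split[OF yA] by simp
  \<comment> \<open>Partial fractions:
    \<open>1 / (w - x) - 1 / (w - y) = (x - y) / ((w - x) * (w - y))\<close>.\<close>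
  have A: "f w / ((w - x) * (\<Prod>t\<in>?A - {w}. w - t)) - f w / ((w - y) * (\<Prod>t\<in>?A - {w}. w - t)) =
     (x - y) * (f w / (\<Prod>t\<in>insert x (insert y ?A) - {w}. w - t))" if w: "w \<in> ?A" for w
  proof -
    have "insert x (insert y ?A) - {w} = insert x (insert y (?A - {w}))" using w xA yA by auto
    then have eq: "(\<Prod>t\<in>insert x (insert y ?A) - {w}. w - t) =
       (w - x) * ((w - y) * (\<Prod>t\<in>?A - {w}. w - t))" using xA yA xy by simp
    have "(\<Prod>t\<in>?A - {w}. w - t) \<noteq> 0" "w - x \<noteq> 0" "w - y \<noteq> 0" using w xA yA by auto
    then show ?thesis unfolding eq
      by (simp add: divide_simps) (simp add: algebra_simps)
  qed
  have X: "(\<Prod>t\<in>insert x (insert y ?A) - {x}. x - t) = (x - y) * (\<Prod>t\<in>?A. x - t)"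
  proof -
    have "insert x (insert y ?A) - {x} = insert y ?A" using xA xy by auto
    then show ?thesis using yA by simp
  qed
  have Y: "(\<Prod>t\<in>insert x (insert y ?A) - {y}. y - t) = (y - x) * (\<Prod>t\<in>?A. y - t)"
  proof -
    have "insert x (insert y ?A) - {y} = insert x ?A" using yA xy by auto
    then show ?thesis using xA by simp
  qed
  have P: "(\<Prod>t\<in>?A. x - t) \<noteq> 0" "(\<Prod>t\<in>?A. y - t) \<noteq> 0" using xA yA by auto
  have "(\<Sum>w\<in>insert x (insert y ?A). f w / (\<Prod>t\<in>insert x (insert y ?A) - {w}. w - t)) =
    f x / ((x - y) * (\<Prod>t\<in>?A. x - t)) + (f y / ((y - x) * (\<Prod>t\<in>?A. y - t)) +
     (\<Sum>w\<in>?A. f w / (\<Prod>t\<in>insert x (insert y ?A) - {w}. w - t)))"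
    using xA yA xy X Y by simp
  then have "(x - y) * (\<Sum>w\<in>insert x (insert y ?A). f w / (\<Prod>t\<in>insert x (insert y ?A) - {w}. w - t)) =
    (x - y) * (f x / ((x - y) * (\<Prod>t\<in>?A. x - t))) + ((x - y) * (f y / ((y - x) * (\<Prod>t\<in>?A. y - t))) +
     (\<Sum>w\<in>?A. (x - y) * (f w / (\<Prod>t\<in>insert x (insert y ?A) - {w}. w - t))))"
    by (simp add: distrib_left sum_distrib_left)
  also have "(x - y) * (f x / ((x - y) * (\<Prod>t\<in>?A. x - t))) = f x / (\<Prod>t\<in>?A. x - t)"
    using xy by simp
  also have "(x - y) * (f y / ((y - x) * (\<Prod>t\<in>?A. y - t))) = - (f y / (\<Prod>t\<in>?A. y - t))"
    using xy P by (simp add: field_simps)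
  also have "(\<Sum>w\<in>?A. (x - y) * (f w / (\<Prod>t\<in>insert x (insert y ?A) - {w}. w - t))) =
    (\<Sum>w\<in>?A. f w / ((w - x) * (\<Prod>t\<in>?A - {w}. w - t)) - f w / ((w - y) * (\<Prod>t\<in>?A - {w}. w - t)))"
    by (rule sum.cong) (simp_all only: A)
  finally have "(x - y) * (\<Sum>w\<in>insert x (insert y ?A). f w / (\<Prod>t\<in>insert x (insert y ?A) - {w}. w - t)) =
    diff_quot f (x # zs) - diff_quot f (y # zs)"
    unfolding x y sum_subtractf by simp
  then show ?case using xy by (simp add: field_simps)
qed simp_all

lemma diff_quot_cong_set:
  "distinct xs \<Longrightarrow> distinct ys \<Longrightarrow> set xs = set ys \<Longrightarrow> diff_quot f xs = diff_quot f ys"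
  by (simp add: diff_quot_eq_sum)

section \<open>The ultrametric absolute value\<close>

context local_field
begin

abbreviation R where "R \<equiv> val_ring v"
abbreviation av where "av \<equiv> absv v"
abbreviation q where "q \<equiv> real (card (residue_field v))"

lemma v_one [simp]: "v 1 = 0"
  using v_mult[of 1 1] by simp

lemma v_minus [simp]: "v (- x) = v x"
proof (cases "x = 0")
  case False
  have "v (-1) + v (-1) = 0" using v_mult[of "-1" "-1"] by simp
  then show ?thesis using v_mult[of "-1" x] False by simp
qed simp

lemma zero_in_R [simp]: "0 \<in> R" and one_in_R [simp]: "1 \<in> R"
  by (simp_all add: val_ring_def)

text \<open>The residue classes of 0 and 1 are distinct. Hence the absolute value is strictly
  decreasing in the valuation.\<close>

lemma q_gt_1: "q > 1"
proof -
  let ?r = "{(x, y). x \<in> R \<and> y \<in> R \<and> x - y \<in> max_ideal v}"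
  have "?r `` {0} \<in> residue_field v" "?r `` {1} \<in> residue_field v"
    unfolding residue_field_def by (rule quotientI, simp)+
  moreover have "?r `` {0} \<noteq> ?r `` {1}"
  proof -
    have "0 \<in> ?r `` {0}" "0 \<notin> ?r `` {1}"
      by (auto simp: max_ideal_def)
    then show ?thesis by blast
  qed
  ultimately have "card {?r `` {0}, ?r `` {1}} \<le> card (residue_field v)"
    by (intro card_mono finite_residue_field) auto
  with \<open>?r `` {0} \<noteq> ?r `` {1}\<close> show ?thesis by simp
qed

lemma av_zero [simp]: "av 0 = 0" and av_eq_0 [simp]: "av x = 0 \<longleftrightarrow> x = 0"
  and av_nonneg [simp]: "av x \<ge> 0" and av_one [simp]: "av 1 = 1"
  using q_gt_1 by (auto simp: absv_def)

lemma av_pos [simp]: "av x > 0 \<longleftrightarrow> x \<noteq> 0"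
  using av_nonneg[of x] av_eq_0[of x] by linarith

lemma av_minus [simp]: "av (- x) = av x"
  by (simp add: absv_def)

lemma av_mult: "av (x * y) = av x * av y"
  using q_gt_1 power_int_add[of q "- v x" "- v y"] by (simp add: absv_def v_mult)

lemma av_diff_commute: "av (x - y) = av (y - x)"
  using av_minus[of "x - y"] by simp

lemma av_power: "av (x ^ k) = av x ^ k"
  by (induction k) (simp_all add: av_mult)

lemma av_inverse: "av (inverse x) = inverse (av x)"
proof (cases "x = 0")
  case False
  then have "av x * av (inverse x) = 1" using av_mult[of x "inverse x"] by simp
  then show ?thesis by (simp add: inverse_unique)
qed simp

lemma av_divide: "av (x / y) = av x / av y"
  by (simp add: divide_inverse av_mult av_inverse)

lemma av_add: "av (x + y) \<le> max (av x) (av y)"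
proof (cases "x = 0 \<or> y = 0 \<or> x + y = 0")
  case False
  then have "min (v x) (v y) \<le> v (x + y)" using v_add by blast
  then have "- v (x + y) \<le> max (- v x) (- v y)" by linarith
  then have "q powi (- v (x + y)) \<le> q powi (max (- v x) (- v y))"
    using q_gt_1 by (intro power_int_increasing) auto
  also have "\<dots> \<le> max (q powi (- v x)) (q powi (- v y))"
    by (simp add: max_def)
  finally show ?thesis using False by (simp add: absv_def)
qed (auto simp: le_max_iff_disj)

lemma av_add_less: "av x < r \<Longrightarrow> av y < r \<Longrightarrow> av (x + y) < r"
  using av_add[of x y] by linarith

lemma av_add_le: "av x \<le> r \<Longrightarrow> av y \<le> r \<Longrightarrow> av (x + y) \<le> r"
  using av_add[of x y] by linarith

lemma av_diff_less: "av x < r \<Longrightarrow> av y < r \<Longrightarrow> av (x - y) < r"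
  using av_add_less[of x r "- y"] by simp

lemma av_diff_le: "av x \<le> r \<Longrightarrow> av y \<le> r \<Longrightarrow> av (x - y) \<le> r"
  using av_add_le[of x r "- y"] by simp

text \<open>\<open>r > 0\<close> takes care of empty and infinite index sets, whose sum is 0. The
  bound does not grow with the number of terms, so the estimates below keep the same \<epsilon>
  throughout.\<close>

lemma av_sum_less:
  assumes "r > 0" "\<And>i. i \<in> A \<Longrightarrow> av (g i) < r"
  shows "av (sum g A) < r"
  using assms(2) by (induction A rule: infinite_finite_induct) (auto simp: assms(1) intro: av_add_less)

text \<open>The ultrametric inequality for sums of ones. It makes binomial coefficients harmless in
  every later estimate.\<close>

lemma av_of_nat_le: "av (of_nat k) \<le> 1"
  by (induction k) (auto intro: av_add_le)

text \<open>A strictly smaller perturbation cannot change the absolute value: apply the ultrametric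
  inequality to \<open>x = (x - y) + y\<close> and to \<open>y = x - (x - y)\<close>.\<close>

lemma av_eq_of_diff_less: "av (x - y) < av y \<Longrightarrow> av x = av y"
  using av_add[of "x - y" y] av_diff_le[of x "max (av x) (av (x - y))" "x - y"] by auto

lemma q_powi_le_iff: "q powi m \<le> q powi k \<longleftrightarrow> m \<le> k"
  and q_powi_less_iff: "q powi m < q powi k \<longleftrightarrow> m < k"
  using q_gt_1 power_int_strict_increasing[of m k q] power_int_increasing[of m k q]
    power_int_strict_increasing[of k m q] power_int_increasing[of k m q]
  by (fastforce simp: not_le)+

lemma in_R_iff: "x \<in> R \<longleftrightarrow> av x \<le> 1"
proof (cases "x = 0")
  case False
  then show ?thesis using q_powi_le_iff[of "- v x" 0] by (simp add: absv_def val_ring_def)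
qed simp

lemma in_max_ideal_iff: "x \<in> max_ideal v \<longleftrightarrow> av x < 1"
proof (cases "x = 0")
  case False
  then show ?thesis using q_powi_less_iff[of "- v x" 0] by (simp add: absv_def max_ideal_def)
qed (simp add: max_ideal_def)

lemma R_add: "x \<in> R \<Longrightarrow> y \<in> R \<Longrightarrow> x + y \<in> R"
  and R_diff: "x \<in> R \<Longrightarrow> y \<in> R \<Longrightarrow> x - y \<in> R"
  and R_mult: "x \<in> R \<Longrightarrow> y \<in> R \<Longrightarrow> x * y \<in> R"
  and R_power: "x \<in> R \<Longrightarrow> x ^ k \<in> R"
  by (auto simp: in_R_iff av_mult av_power mult_le_one power_le_one intro: av_add_le av_diff_le)

text \<open>Nonzero absolute values are integral powers of \<open>q\<close>, so the largest one
  below 1 is \<open>inverse q\<close>. This gap turns a congruence of residues into the bound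
  \<open>av \<pi>\<close>.\<close>

lemma av_less_one_iff: "av x < 1 \<longleftrightarrow> av x \<le> inverse q"
proof (cases "x = 0")
  case False
  then show ?thesis using q_powi_less_iff[of "- v x" 0] q_powi_le_iff[of "- v x" "-1"] by (auto simp: absv_def power_int_minus)
qed (use q_gt_1 in simp)

section \<open>Limits and field operations in the valuation topology\<close>

lemma tendsto_av_iff:
  fixes g :: "'b \<Rightarrow> 'a"
  shows "(g \<longlongrightarrow> l) F \<longleftrightarrow> ((\<lambda>x. av (g x - l)) \<longlongrightarrow> 0) F"
  by (subst tendsto_dist_iff) (simp add: dist_eq_absv)

lemma tendsto_lf_add:
  fixes g h :: "'b \<Rightarrow> 'a"
  assumes "(g \<longlongrightarrow> a) F" "(h \<longlongrightarrow> b) F"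
  shows "((\<lambda>x. g x + h x) \<longlongrightarrow> a + b) F"
proof -
  have "((\<lambda>x. av (g x - a) + av (h x - b)) \<longlongrightarrow> 0 + 0) F"
    using assms by (intro tendsto_add) (simp_all only: tendsto_av_iff)
  then have *: "((\<lambda>x. av (g x - a) + av (h x - b)) \<longlongrightarrow> 0) F" by simp
  have "av (g x + h x - (a + b)) \<le> av (g x - a) + av (h x - b)" for x
    unfolding add_diff_add
    by (rule order_trans[OF av_add]) simp
  then show ?thesis unfolding tendsto_av_iff
    by (intro tendsto_sandwich[OF _ _ tendsto_const *]) auto
qed

lemma tendsto_lf_minus:
  fixes g :: "'b \<Rightarrow> 'a"
  shows "(g \<longlongrightarrow> a) F \<Longrightarrow> ((\<lambda>x. - g x) \<longlongrightarrow> - a) F"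
  unfolding tendsto_av_iff using av_diff_commute by (simp add: add.commute)

lemma tendsto_lf_diff:
  fixes g h :: "'b \<Rightarrow> 'a"
  shows "(g \<longlongrightarrow> a) F \<Longrightarrow> (h \<longlongrightarrow> b) F \<Longrightarrow> ((\<lambda>x. g x - h x) \<longlongrightarrow> a - b) F"
  using tendsto_lf_add[OF _ tendsto_lf_minus, of g a F h b] by simp

lemma tendsto_lf_av:
  fixes g :: "'b \<Rightarrow> 'a"
  assumes "(g \<longlongrightarrow> a) F" shows "((\<lambda>x. av (g x)) \<longlongrightarrow> av a) F"
  using tendsto_dist[OF assms tendsto_const[of 0]] by (simp add: dist_eq_absv)

lemma tendsto_lf_mult:
  fixes g h :: "'b \<Rightarrow> 'a"
  assumes "(g \<longlongrightarrow> a) F" "(h \<longlongrightarrow> b) F"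
  shows "((\<lambda>x. g x * h x) \<longlongrightarrow> a * b) F"
proof -
  have "((\<lambda>x. av (g x) * av (h x - b) + av (g x - a) * av b) \<longlongrightarrow> av a * 0 + 0 * av b) F"
    using assms by (intro tendsto_intros tendsto_lf_av) (simp_all only: tendsto_av_iff)
  then have *: "((\<lambda>x. av (g x) * av (h x - b) + av (g x - a) * av b) \<longlongrightarrow> 0) F" by simp
  have "av (g x * h x - a * b) \<le> av (g x) * av (h x - b) + av (g x - a) * av b" for x
  proof -
    have "g x * h x - a * b = g x * (h x - b) + (g x - a) * b" by (simp add: algebra_simps)
    then have "av (g x * h x - a * b) \<le> max (av (g x) * av (h x - b)) (av (g x - a) * av b)"
      using av_add by (metis av_mult)
    also have "\<dots> \<le> av (g x) * av (h x - b) + av (g x - a) * av b" by simp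
    finally show ?thesis .
  qed
  then show ?thesis unfolding tendsto_av_iff[of "\<lambda>x. g x * h x"]
    by (intro tendsto_sandwich[OF _ _ tendsto_const *]) auto
qed

lemma tendsto_lf_sum:
  fixes g :: "'i \<Rightarrow> 'b \<Rightarrow> 'a"
  shows "(\<And>i. i \<in> A \<Longrightarrow> (g i \<longlongrightarrow> a i) F) \<Longrightarrow> ((\<lambda>x. \<Sum>i\<in>A. g i x) \<longlongrightarrow> (\<Sum>i\<in>A. a i)) F"
  by (induction A rule: infinite_finite_induct) (auto intro: tendsto_lf_add)

lemma tendsto_lf_power:
  fixes g :: "'b \<Rightarrow> 'a"
  shows "(g \<longlongrightarrow> a) F \<Longrightarrow> ((\<lambda>x. g x ^ k) \<longlongrightarrow> a ^ k) F"
  by (induction k) (auto intro: tendsto_lf_mult)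

lemma tendsto_lf_divide:
  fixes g h :: "'b \<Rightarrow> 'a"
  assumes g: "(g \<longlongrightarrow> a) F" and h: "(h \<longlongrightarrow> b) F" and b: "b \<noteq> 0"
  shows "((\<lambda>x. g x / h x) \<longlongrightarrow> a / b) F"
proof -
  have "((\<lambda>x. inverse (h x)) \<longlongrightarrow> inverse b) F"
    unfolding tendsto_av_iff[of "\<lambda>x. inverse (h x)"]
  proof (rule Lim_transform_eventually)
    have "((\<lambda>x. av (h x - b) / (av (h x) * av b)) \<longlongrightarrow> 0 / (av b * av b)) F"
      using h b by (intro tendsto_intros tendsto_lf_av) (simp_all add: tendsto_av_iff[symmetric])
    then show "((\<lambda>x. av (h x - b) / (av (h x) * av b)) \<longlongrightarrow> 0) F" by simp
    have "eventually (\<lambda>x. av (h x) \<in> {0<..}) F"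
      using tendsto_lf_av[OF h] b by (intro topological_tendstoD) auto
    then show "eventually (\<lambda>x. av (h x - b) / (av (h x) * av b) = av (inverse (h x) - inverse b)) F"
    proof eventually_elim
      case (elim x)
      then have "inverse (h x) - inverse b = - ((h x - b) / (h x * b))"
        using b by (simp add: field_simps)
      then show ?case by (simp only: av_minus av_divide av_mult)
    qed
  qed
  from tendsto_lf_mult[OF g this] show ?thesis by (simp add: divide_inverse)
qed

lemma eventually_neq_of_tendsto:
  fixes g :: "'b \<Rightarrow> 'a"
  assumes "(g \<longlongrightarrow> a) F" "a \<noteq> b"
  shows "eventually (\<lambda>x. g x \<noteq> b) F"
  using topological_tendstoD[OF assms(1), of "- {b}"] assms(2) by (simp add: open_Compl)

section \<open>Approximation by tuples with distinct entries\<close>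

lemma exists_uniformizer: "\<exists>\<pi>. uniformizer v \<pi>"
  using v_surj[of 1] by (simp add: uniformizer_def)

lemma av_uniformizer: "uniformizer v \<pi> \<Longrightarrow> av \<pi> = inverse q"
  by (simp add: uniformizer_def absv_def power_int_minus)

lemma tendsto_power_zero:
  assumes "av \<pi> < 1"
  shows "(\<lambda>N. \<pi> ^ N) \<longlonglongrightarrow> 0"
  unfolding tendsto_av_iff using assms by (simp add: av_power LIMSEQ_realpow_zero)

text \<open>Adding \<open>\<pi> ^ (N + i)\<close> to entry \<open>i\<close> separates equal entries,
  since these powers have different absolute values, while unequal entries stay apart for large
  \<open>N\<close> by convergence. Identities between difference quotients at distinct points
  thereby pass to repeated points.\<close>

lemma distinct_approximation:
  assumes "set zs \<subseteq> R"
  obtains us :: "(nat \<Rightarrow> 'a) list"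
  where "list_all2 (\<lambda>u z. u \<longlonglongrightarrow> z) us zs"
    and "\<forall>\<^sub>F N in sequentially. distinct (map (\<lambda>u. u N) us)"
    and "\<forall>\<^sub>F N in sequentially. set (map (\<lambda>u. u N) us) \<subseteq> R"
proof -
  obtain \<pi> where pi: "uniformizer v \<pi>" using exists_uniformizer by blast
  have pi0: "\<pi> \<noteq> 0" using pi by (simp add: uniformizer_def)
  then have avpos: "0 < av \<pi>" by simp
  have av1: "av \<pi> < 1"
    unfolding av_uniformizer[OF pi] using q_gt_1 by (simp add: inverse_less_1_iff)
  define us where "us = map (\<lambda>i N. zs ! i + \<pi> ^ (N + i)) [0..<length zs]"
  have lim: "(\<lambda>N. z + \<pi> ^ (N + i)) \<longlonglongrightarrow> z" for z i
    using tendsto_lf_add[OF tendsto_const LIMSEQ_ignore_initial_segment[OF tendsto_power_zero[OF av1]],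
        of z i] by simp
  have 1: "list_all2 (\<lambda>u z. u \<longlonglongrightarrow> z) us zs"
    by (simp add: us_def list_all2_conv_all_nth lim)
  have ne: "\<forall>\<^sub>F N in sequentially. zs ! i + \<pi> ^ (N + i) \<noteq> zs ! j + \<pi> ^ (N + j)"
    if "i \<noteq> j" for i j
  proof (cases "zs ! i = zs ! j")
    case True
    have "\<pi> ^ (N + i) \<noteq> \<pi> ^ (N + j)" for N
    proof
      assume "\<pi> ^ (N + i) = \<pi> ^ (N + j)"
      then have "av \<pi> ^ (N + i) = av \<pi> ^ (N + j)" by (simp flip: av_power)
      then show False using that av1 avpos by (simp add: power_inject_exp')
    qed
    with True show ?thesis by simp
  next
    case False
    have "(\<lambda>N. (zs ! i + \<pi> ^ (N + i)) - (zs ! j + \<pi> ^ (N + j))) \<longlonglongrightarrow> zs ! i - zs ! j"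
      by (intro tendsto_lf_diff lim)
    from eventually_neq_of_tendsto[OF this, of 0] False show ?thesis by simp
  qed
  then have "\<forall>\<^sub>F N in sequentially. \<forall>i\<in>{..<length zs}. \<forall>j\<in>{..<length zs}. i \<noteq> j \<longrightarrow>
      zs ! i + \<pi> ^ (N + i) \<noteq> zs ! j + \<pi> ^ (N + j)"
    by (intro eventually_ball_finite ballI) (auto intro: eventually_mono)
  then have 2: "\<forall>\<^sub>F N in sequentially. distinct (map (\<lambda>u. u N) us)"
    by eventually_elim (auto simp: us_def distinct_conv_nth)
  have "\<pi> \<in> R" using av1 by (simp add: in_R_iff)
  moreover have "zs ! i \<in> R" if "i < length zs" for i
    using that assms nth_mem by blast
  ultimately have "set (map (\<lambda>u. u N) us) \<subseteq> R" for N
    by (auto simp: us_def intro!: R_add R_power)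
  then have 3: "\<forall>\<^sub>F N in sequentially. set (map (\<lambda>u. u N) us) \<subseteq> R"
    by (intro always_eventually allI)
  show thesis by (rule that[OF 1 2 3])
qed

text \<open>Approximating a list of \<open>Suc (card R)\<close> zeros by distinct elements of
  \<open>R\<close> would overfill a finite \<open>R\<close>.\<close>

lemma infinite_R: "infinite R"
proof
  assume fin: "finite R"
  obtain us :: "(nat \<Rightarrow> 'a) list" where us: "list_all2 (\<lambda>u z. u \<longlonglongrightarrow> z) us (replicate (Suc (card R)) 0)"
    "\<forall>\<^sub>F N in sequentially. distinct (map (\<lambda>u. u N) us)"
    "\<forall>\<^sub>F N in sequentially. set (map (\<lambda>u. u N) us) \<subseteq> R"
    by (rule distinct_approximation[of "replicate (Suc (card R)) 0"]) auto
  from eventually_happens'[OF sequentially_bot eventually_conj[OF us(2,3)]]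
  obtain N where N: "distinct (map (\<lambda>u. u N) us)" "set (map (\<lambda>u. u N) us) \<subseteq> R"
    by blast
  have "length us = card (set (map (\<lambda>u. u N) us))"
    using distinct_card[OF N(1)] by simp
  also have "\<dots> \<le> card R" using N(2) fin by (rule card_mono[rotated])
  finally show False using list_all2_lengthD[OF us(1)] by simp
qed

section \<open>Extending difference quotients to repeated arguments\<close>

abbreviation tup :: "'a list \<Rightarrow> nat \<Rightarrow> 'a" where
  "tup xs \<equiv> (\<lambda>i\<in>{..<length xs}. xs ! i)"

lemma tup_map_upt: "z \<in> tuples v k \<Longrightarrow> tup (map z [0..<k]) = z"
  by (auto simp: tuples_def PiE_iff extensional_def fun_eq_iff)

lemma tuples_mem: "z \<in> tuples v k \<Longrightarrow> i < k \<Longrightarrow> z i \<in> R"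
  using PiE_mem[of z "{..<k}" "\<lambda>_. R" i] by (simp add: tuples_def)

lemma set_map_tuple: "z \<in> tuples v k \<Longrightarrow> set is \<subseteq> {..<k} \<Longrightarrow> set (map z is) \<subseteq> R"
  by (auto intro: tuples_mem)

lemma map_tup: "map (tup xs) [0..<length xs] = xs"
  by (rule nth_equalityI) auto

lemma Phi_tup: "length xs = Suc k \<Longrightarrow> Phi k f (tup xs) = diff_quot f xs"
  unfolding Phi_def using map_tup[of xs] by simp

lemma tup_in_tuples: "set xs \<subseteq> R \<Longrightarrow> length xs = k \<Longrightarrow> tup xs \<in> tuples v k"
  by (auto simp: tuples_def)

lemma tup_in_distinct_tuples:
  "set xs \<subseteq> R \<Longrightarrow> distinct xs \<Longrightarrow> length xs = k \<Longrightarrow> tup xs \<in> distinct_tuples v k"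
  by (auto simp: distinct_tuples_def tup_in_tuples inj_on_def nth_eq_iff_index_eq)

lemma distinct_tuples_subset: "distinct_tuples v k \<subseteq> tuples v k"
  by (auto simp: distinct_tuples_def)

lemma tup_tendsto:
  assumes "list_all2 (\<lambda>u z. (u \<longlongrightarrow> z) F) us zs"
  shows "((\<lambda>p. tup (map (\<lambda>u. u p) us)) \<longlongrightarrow> tup zs) F"
  using assms by (intro tendsto_fun_componentwise) (auto simp: list_all2_conv_all_nth restrict_def)

lemma extends_Phi_tendsto:
  assumes "extends_Phi v k f S g" and "tup zs \<in> S"
    and "list_all2 (\<lambda>u z. (u \<longlongrightarrow> z) F) us zs"
    and "\<forall>\<^sub>F p in F. tup (map (\<lambda>u. u p) us) \<in> S"
  shows "((\<lambda>p. g (tup (map (\<lambda>u. u p) us))) \<longlongrightarrow> g (tup zs)) F"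
  using assms by (intro continuous_on_tendsto_compose[OF _ tup_tendsto]) (auto simp: extends_Phi_def)

lemma extends_Phi_tendsto_distinct:
  assumes ext: "extends_Phi v k f S g" and S: "distinct_tuples v (Suc k) \<subseteq> S"
    and z: "tup zs \<in> S" and len: "length zs = Suc k"
    and lim: "list_all2 (\<lambda>u z. (u \<longlongrightarrow> z) F) us zs"
    and ev: "\<forall>\<^sub>F p in F. distinct (map (\<lambda>u. u p) us)"
    and R: "\<forall>\<^sub>F p in F. set (map (\<lambda>u. u p) us) \<subseteq> R"
  shows "((\<lambda>p. diff_quot f (map (\<lambda>u. u p) us)) \<longlongrightarrow> g (tup zs)) F"
proof -
  have len': "length us = Suc k" using lim len by (simp add: list_all2_lengthD)
  have dt: "\<forall>\<^sub>F p in F. tup (map (\<lambda>u. u p) us) \<in> distinct_tuples v (Suc k)"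
    using ev R by eventually_elim (rule tup_in_distinct_tuples, auto simp: len')
  then have "\<forall>\<^sub>F p in F. tup (map (\<lambda>u. u p) us) \<in> S"
    by eventually_elim (use S in blast)
  from extends_Phi_tendsto[OF ext z lim this]
  show ?thesis
  proof (rule Lim_transform_eventually)
    show "\<forall>\<^sub>F p in F. g (tup (map (\<lambda>u. u p) us)) = diff_quot f (map (\<lambda>u. u p) us)"
      using dt
    proof eventually_elim
      case (elim p)
      then have "g (tup (map (\<lambda>u. u p) us)) = Phi k f (tup (map (\<lambda>u. u p) us))"
        using ext by (simp add: extends_Phi_def)
      then show ?case using Phi_tup[of "map (\<lambda>u. u p) us" k f] len' by simp
    qed
  qed
qed

text \<open>Both values are limits of the same difference quotients along distinct tuples. Hence the
  choice made in \<open>Phi_ext\<close> does not affect its values on \<open>S\<close>.\<close>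

lemma extends_Phi_unique:
  assumes "extends_Phi v k f S g" "extends_Phi v k f S h"
    and S: "distinct_tuples v (Suc k) \<subseteq> S" "S \<subseteq> tuples v (Suc k)" and z: "z \<in> S"
  shows "g z = h z"
proof -
  let ?zs = "map z [0..<Suc k]"
  have zt: "z \<in> tuples v (Suc k)" using z S by blast
  have zS: "tup ?zs \<in> S" using z by (simp only: tup_map_upt[OF zt])
  have "set ?zs \<subseteq> R" by (rule set_map_tuple[OF zt]) auto
  then obtain us where us: "list_all2 (\<lambda>u z. u \<longlonglongrightarrow> z) us ?zs"
    "\<forall>\<^sub>F N in sequentially. distinct (map (\<lambda>u. u N) us)"
    "\<forall>\<^sub>F N in sequentially. set (map (\<lambda>u. u N) us) \<subseteq> R"
    by (rule distinct_approximation)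
  have len: "length ?zs = Suc k" by simp
  have "g (tup ?zs) = h (tup ?zs)"
    by (rule LIMSEQ_unique[OF extends_Phi_tendsto_distinct[OF assms(1) S(1) zS len us]
          extends_Phi_tendsto_distinct[OF assms(2) S(1) zS len us]])
  then show ?thesis by (simp only: tup_map_upt[OF zt])
qed

lemma extends_Phi_ext: "extends_Phi v k f S g \<Longrightarrow> extends_Phi v k f S (Phi_ext v k f S)"
  unfolding Phi_ext_def by (rule someI[of "extends_Phi v k f S"])

lemma distinct_tuples_dense:
  assumes "z \<in> tuples v k"
  shows "inf (nhds z) (principal (distinct_tuples v k)) \<noteq> bot"
proof
  assume bot: "inf (nhds z) (principal (distinct_tuples v k)) = bot"
  have "set (map z [0..<k]) \<subseteq> R" by (rule set_map_tuple[OF assms]) auto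
  then obtain us where us: "list_all2 (\<lambda>u z. u \<longlonglongrightarrow> z) us (map z [0..<k])"
    "\<forall>\<^sub>F N in sequentially. distinct (map (\<lambda>u. u N) us)"
    "\<forall>\<^sub>F N in sequentially. set (map (\<lambda>u. u N) us) \<subseteq> R"
    by (rule distinct_approximation)
  let ?X = "\<lambda>N. tup (map (\<lambda>u. u N) us)"
  have len: "length us = k" using us(1) by (simp add: list_all2_lengthD)
  have "?X \<longlonglongrightarrow> z"
    using tup_tendsto[OF us(1)] by (simp only: tup_map_upt[OF assms])
  moreover have "\<forall>\<^sub>F N in sequentially. ?X N \<in> distinct_tuples v k"
    using us(2,3) by eventually_elim (rule tup_in_distinct_tuples, auto simp: len)
  ultimately have "filterlim ?X (inf (nhds z) (principal (distinct_tuples v k))) sequentially"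
    by (simp add: filterlim_inf filterlim_principal)
  then show False
    by (simp add: bot filterlim_def bot.extremum_unique filtermap_bot_iff)
qed

lemma extends_Phi_exI:
  assumes S: "distinct_tuples v (Suc k) \<subseteq> S" "S \<subseteq> tuples v (Suc k)"
    and lim: "\<And>z. z \<in> S \<Longrightarrow>
      \<exists>l. (Phi k f \<longlongrightarrow> l) (inf (nhds z) (principal (distinct_tuples v (Suc k))))"
  shows "\<exists>g. extends_Phi v k f S g"
proof -
  obtain g where "continuous_on S g" "\<And>x. x \<in> distinct_tuples v (Suc k) \<Longrightarrow> g x = Phi k f x"
    using continuous_extension_by_limits[OF S(1) distinct_tuples_dense lim] S(2) by blast
  then show ?thesis by (auto simp: extends_Phi_def)
qed

text \<open>The points \<open>X p i\<close> are replaced one at a time by fixed points \<open>b\<close> away from the limit points,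
  where the difference quotient of one order higher controls the error.\<close>

lemma diff_quot_tendsto_mixed:
  fixes X :: "'b \<Rightarrow> nat \<Rightarrow> 'a"
  assumes f: "f \<in> C_k v (Suc k)"
    and "\<And>i. i \<in> set is \<Longrightarrow> ((\<lambda>p. X p i) \<longlongrightarrow> z i) F"
    and "\<forall>\<^sub>F p in F. distinct (map (X p) is) \<and> set (map (X p) is) \<subseteq> R"
    and "z ` set is \<subseteq> R" and "distinct bs" and "set bs \<subseteq> R" and "set bs \<inter> z ` set is = {}"
    and "length is + length bs = Suc k"
  shows "\<exists>l. ((\<lambda>p. diff_quot f (map (X p) is @ bs)) \<longlongrightarrow> l) F"
  using assms(2-)
proof (induction "is" arbitrary: bs)
  case Nil
  then show ?case by auto
next
  case (Cons i "is")
  \<comment> \<open>The replacement point \<open>b\<close> has to avoid the fixed points and all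
    limit points, so that the entries of the longer list are eventually distinct along
    \<open>F\<close>.\<close>
  have "infinite (R - (set bs \<union> z ` set (i # is)))"
    using infinite_R by (intro Diff_infinite_finite) auto
  then have "R - (set bs \<union> z ` set (i # is)) \<noteq> {}" by (metis finite.emptyI)
  then obtain b where b: "b \<in> R" "b \<notin> set bs" "b \<notin> z ` set (i # is)" by blast
  have "\<exists>l. ((\<lambda>p. diff_quot f (map (X p) is @ (b # bs))) \<longlongrightarrow> l) F"
  proof (rule Cons.IH)
    show "\<forall>\<^sub>F p in F. distinct (map (X p) is) \<and> set (map (X p) is) \<subseteq> R"
      using Cons.prems(2) by eventually_elim auto
  qed (use Cons.prems b in auto)
  then obtain l where l: "((\<lambda>p. diff_quot f (map (X p) is @ (b # bs))) \<longlongrightarrow> l) F" ..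
  obtain g where g: "extends_Phi v (Suc k) f (tuples v (Suc (Suc k))) g"
    using f by (auto simp: C_k_def)
  define us where "us = map (\<lambda>i p. X p i) (i # is) @ map (\<lambda>b p. b) (b # bs)"
  define zs where "zs = map z (i # is) @ (b # bs)"
  have us: "map (\<lambda>u. u p) us = map (X p) (i # is) @ b # bs" for p
    by (simp add: us_def comp_def)
  have avoid: "\<forall>\<^sub>F p in F. \<forall>j\<in>set (i # is). \<forall>c\<in>set (b # bs). X p j \<noteq> c"
    using Cons.prems(1,6) b
    by (intro eventually_ball_finite ballI eventually_neq_of_tendsto) auto
  have dist: "\<forall>\<^sub>F p in F. distinct (map (\<lambda>u. u p) us)"
    using avoid Cons.prems(2)
    by eventually_elim (use Cons.prems(4) b in \<open>auto simp: us\<close>)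
  have lim: "((\<lambda>p. diff_quot f (map (\<lambda>u. u p) us)) \<longlongrightarrow> g (tup zs)) F"
  proof (rule extends_Phi_tendsto_distinct[OF g distinct_tuples_subset _ _ _ dist])
    show "tup zs \<in> tuples v (Suc (Suc k))"
      using Cons.prems b by (intro tup_in_tuples) (auto simp: zs_def)
    show "length zs = Suc (Suc k)" using Cons.prems(7) by (simp add: zs_def)
    show "list_all2 (\<lambda>u z. (u \<longlongrightarrow> z) F) us zs"
      unfolding us_def zs_def
      by (rule list_all2_appendI)
        (use Cons.prems(1) in \<open>auto simp: list_all2_map1 list_all2_map2 list.rel_map intro!: list.rel_refl_strong\<close>)
    show "\<forall>\<^sub>F p in F. set (map (\<lambda>u. u p) us) \<subseteq> R"
      using Cons.prems(2) by eventually_elim (use Cons.prems(5) b in \<open>auto simp: us\<close>)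
  qed
  have zi: "((\<lambda>p. X p i - b) \<longlongrightarrow> z i - b) F"
    using Cons.prems(1) by (intro tendsto_lf_diff) auto
  \<comment> \<open>This is the recursion solved for the quotient containing \<open>X p i\<close>:
    exchanging that entry for \<open>b\<close> costs \<open>X p i - b\<close> times a quotient of
    order \<open>Suc k\<close>, which converges because \<open>f\<close> is in
    \<open>C_k v (Suc k)\<close>.\<close>
  have "((\<lambda>p. diff_quot f (map (X p) is @ (b # bs)) + (X p i - b) * diff_quot f (map (\<lambda>u. u p) us)) \<longlongrightarrow>
      l + (z i - b) * g (tup zs)) F"
    by (intro tendsto_lf_add tendsto_lf_mult l lim zi)
  then have "((\<lambda>p. diff_quot f (map (X p) (i # is) @ bs)) \<longlongrightarrow> l + (z i - b) * g (tup zs)) F"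
  proof (rule Lim_transform_eventually)
    show "\<forall>\<^sub>F p in F. diff_quot f (map (X p) is @ (b # bs)) + (X p i - b) * diff_quot f (map (\<lambda>u. u p) us)
        = diff_quot f (map (X p) (i # is) @ bs)"
      using dist avoid
    proof eventually_elim
      case (elim p)
      have 1: "diff_quot f (map (\<lambda>u. u p) us) = diff_quot f (X p i # b # (map (X p) is @ bs))"
        using elim(1) unfolding us by (intro diff_quot_cong_set) auto
      have 2: "diff_quot f (map (X p) is @ (b # bs)) = diff_quot f (b # (map (X p) is @ bs))"
        using elim(1) unfolding us by (intro diff_quot_cong_set) auto
      have "X p i - b \<noteq> 0" using elim(2) by simp
      then show ?case unfolding 1 2 by simp
    qed
  qed
  then show ?case by blast
qed

lemma tendsto_inf_principal_component:
  fixes z :: "nat \<Rightarrow> 'a"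
  shows "((\<lambda>x. x i) \<longlongrightarrow> z i) (inf (nhds z) (principal A))"
proof (rule tendsto_fun_component[of "\<lambda>x. x" z])
  show "((\<lambda>x. x) \<longlongrightarrow> z) (inf (nhds z) (principal A))"
    by (rule filterlim_mono[OF filterlim_ident order_refl inf_le1])
qed

lemma eventually_inf_principal_distinct:
  assumes "distinct is" "set is \<subseteq> {..<k}"
  shows "\<forall>\<^sub>F x in inf (nhds z) (principal (distinct_tuples v k)).
    distinct (map x is) \<and> set (map x is) \<subseteq> R"
  unfolding eventually_inf_principal
proof (intro always_eventually allI impI)
  fix x assume x: "x \<in> distinct_tuples v k"
  then have "inj_on x (set is)" using assms by (auto simp: distinct_tuples_def intro: inj_on_subset)
  moreover have "set (map x is) \<subseteq> R"
    using x distinct_tuples_subset assms(2) by (blast intro: set_map_tuple[THEN subsetD])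
  ultimately show "distinct (map x is) \<and> set (map x is) \<subseteq> R"
    using assms by (simp add: distinct_map)
qed

section \<open>Divided differences with repeated entries for functions of class
  \<open>C_k v n\<close>\<close>

lemma C_k_Suc: assumes "f \<in> C_k v (Suc k)" shows "f \<in> C_k v k"
proof -
  have "\<exists>g. extends_Phi v k f (tuples v (Suc k)) g"
  proof (rule extends_Phi_exI[OF distinct_tuples_subset subset_refl])
    fix z assume z: "z \<in> tuples v (Suc k)"
    have "\<exists>l. ((\<lambda>x. diff_quot f (map x [0..<Suc k] @ [])) \<longlongrightarrow> l)
        (inf (nhds z) (principal (distinct_tuples v (Suc k))))"
      by (rule diff_quot_tendsto_mixed[OF assms tendsto_inf_principal_component
            eventually_inf_principal_distinct])
        (use z in \<open>auto intro: tuples_mem\<close>)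
    then show "\<exists>l. (Phi k f \<longlongrightarrow> l) (inf (nhds z) (principal (distinct_tuples v (Suc k))))"
      by (simp add: Phi_def[abs_def])
  qed
  then show ?thesis by (simp add: C_k_def)
qed

lemma C_k_antimono: "k \<le> n \<Longrightarrow> f \<in> C_k v n \<Longrightarrow> f \<in> C_k v k"
  by (induction rule: inc_induct) (auto intro: C_k_Suc)

text \<open>For \<open>f\<close> in \<open>C_k v n\<close> this is the divided difference with
  arbitrary repetitions, meaningful for lists of up to \<open>n + 1\<close> entries. The order is
  read off from the length of the list.\<close>

definition dd :: "('a \<Rightarrow> 'a) \<Rightarrow> 'a list \<Rightarrow> 'a" where
  "dd f xs = Phi_ext v (length xs - 1) f (tuples v (length xs)) (tup xs)"

lemma extends_Phi_tuples:
  assumes "f \<in> C_k v n" "k \<le> n"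
  shows "extends_Phi v k f (tuples v (Suc k)) (Phi_ext v k f (tuples v (Suc k)))"
proof -
  obtain g where "extends_Phi v k f (tuples v (Suc k)) g"
    using C_k_antimono[OF assms(2,1)] by (auto simp: C_k_def)
  then show ?thesis by (rule extends_Phi_ext)
qed

lemma dd_tendsto:
  assumes "f \<in> C_k v n" and "zs \<noteq> []" and "length zs \<le> Suc n" and "set zs \<subseteq> R"
    and "list_all2 (\<lambda>u z. (u \<longlongrightarrow> z) F) us zs"
    and "\<forall>\<^sub>F p in F. set (map (\<lambda>u. u p) us) \<subseteq> R"
  shows "((\<lambda>p. dd f (map (\<lambda>u. u p) us)) \<longlongrightarrow> dd f zs) F"
proof -
  obtain k where k: "length zs = Suc k" using assms(2) by (cases zs) auto
  have len: "length us = Suc k" using assms(5) k by (simp add: list_all2_lengthD)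
  have "extends_Phi v k f (tuples v (Suc k)) (Phi_ext v k f (tuples v (Suc k)))"
    using assms(1,3) k by (intro extends_Phi_tuples) auto
  moreover have "\<forall>\<^sub>F p in F. tup (map (\<lambda>u. u p) us) \<in> tuples v (Suc k)"
    using assms(6) by eventually_elim (rule tup_in_tuples, auto simp: len)
  ultimately show ?thesis
    using extends_Phi_tendsto[OF _ tup_in_tuples[OF assms(4) k] assms(5)]
    by (simp add: dd_def k len)
qed

lemma dd_distinct:
  assumes "f \<in> C_k v n" and "length xs \<le> Suc n" and "xs \<noteq> []" and "set xs \<subseteq> R" and "distinct xs"
  shows "dd f xs = diff_quot f xs"
proof -
  obtain k where k: "length xs = Suc k" using assms(3) by (cases xs) auto
  have "extends_Phi v k f (tuples v (Suc k)) (Phi_ext v k f (tuples v (Suc k)))"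
    using assms(1,2) k by (intro extends_Phi_tuples) auto
  then show ?thesis
    using tup_in_distinct_tuples[OF assms(4,5) k] Phi_tup[OF k]
    by (simp add: dd_def k extends_Phi_def)
qed

text \<open>The recursion at distinct approximating points, passed to the limit. It is
  cross-multiplied so that it also covers \<open>x = y\<close>.\<close>

lemma dd_rec:
  assumes f: "f \<in> C_k v n" and len: "length zs + 2 \<le> Suc n"
    and R: "set (x # y # zs) \<subseteq> R"
  shows "dd f (x # zs) - dd f (y # zs) = (x - y) * dd f (x # y # zs)"
proof -
  obtain us where us: "list_all2 (\<lambda>u z. u \<longlonglongrightarrow> z) us (x # y # zs)"
    "\<forall>\<^sub>F N in sequentially. distinct (map (\<lambda>u. u N) us)"
    "\<forall>\<^sub>F N in sequentially. set (map (\<lambda>u. u N) us) \<subseteq> R"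
    by (rule distinct_approximation[OF R])
  then obtain a b cs where cs: "us = a # b # cs"
    and ab: "a \<longlonglongrightarrow> x" "b \<longlonglongrightarrow> y" "list_all2 (\<lambda>u z. u \<longlonglongrightarrow> z) cs zs"
    by (auto simp: list_all2_Cons2)
  have l: "length cs = length zs" using ab(3) by (rule list_all2_lengthD)
  have *: "(\<lambda>N. dd f (map (\<lambda>u. u N) ws)) \<longlonglongrightarrow> dd f ys"
    if "ys \<noteq> []" "length ys \<le> Suc n" "set ys \<subseteq> R" "set ws \<subseteq> set us" "list_all2 (\<lambda>u z. u \<longlonglongrightarrow> z) ws ys"
    for ys ws
  proof (rule dd_tendsto[OF f])
    show "\<forall>\<^sub>F N in sequentially. set (map (\<lambda>u. u N) ws) \<subseteq> R"
      using us(3) by eventually_elim (use that(4) in auto)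
  qed (use that in auto)
  have L1: "(\<lambda>N. dd f (map (\<lambda>u. u N) (a # cs)) - dd f (map (\<lambda>u. u N) (b # cs))) \<longlonglongrightarrow> dd f (x # zs) - dd f (y # zs)"
    by (intro tendsto_lf_diff *) (use R len ab in \<open>auto simp: cs\<close>)
  have L2: "(\<lambda>N. (a N - b N) * dd f (map (\<lambda>u. u N) us)) \<longlonglongrightarrow> (x - y) * dd f (x # y # zs)"
    by (intro tendsto_lf_mult tendsto_lf_diff *) (use R len ab us(1) in auto)
  have ev: "\<forall>\<^sub>F N in sequentially. (a N - b N) * dd f (map (\<lambda>u. u N) us) =
     dd f (map (\<lambda>u. u N) (a # cs)) - dd f (map (\<lambda>u. u N) (b # cs))"
    using us(2,3)
  proof eventually_elim
    case (elim N)
    have "dd f (map (\<lambda>u. u N) ws) = diff_quot f (map (\<lambda>u. u N) ws)"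
      if "ws \<in> {us, a # cs, b # cs}" for ws
      using that elim len l by (intro dd_distinct[OF f]) (auto simp: cs image_subset_iff)
    from this[of us] this[of "a # cs"] this[of "b # cs"] show ?case using elim by (simp add: cs)
  qed
  show ?thesis
    by (rule LIMSEQ_unique[OF L1 Lim_transform_eventually[OF L2 ev]])
qed

text \<open>Symmetry survives the limit. Since entries may repeat, lists are compared by
  \<open>mset\<close> and not by \<open>set\<close>.\<close>

lemma dd_mset:
  assumes f: "f \<in> C_k v n" and len: "length xs \<le> Suc n" "xs \<noteq> []"
    and R: "set xs \<subseteq> R" and perm: "mset ys = mset xs"
  shows "dd f ys = dd f xs"
proof -
  obtain us where us: "list_all2 (\<lambda>u z. u \<longlonglongrightarrow> z) us xs"
    "\<forall>\<^sub>F N in sequentially. distinct (map (\<lambda>u. u N) us)"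
    "\<forall>\<^sub>F N in sequentially. set (map (\<lambda>u. u N) us) \<subseteq> R"
    by (rule distinct_approximation[OF R])
  have "list_all2 (\<lambda>z u. u \<longlonglongrightarrow> z) xs us" using us(1) by (simp add: list_all2_conv_all_nth)
  \<comment> \<open>The approximating sequences are permuted along with their limits.\<close>
  then obtain ws where ws: "list_all2 (\<lambda>z u. u \<longlonglongrightarrow> z) ys ws" "mset ws = mset us"
    using list_all2_reorder_left_invariance[OF _ perm] by blast
  have ws1: "list_all2 (\<lambda>u z. u \<longlonglongrightarrow> z) ws ys" using ws(1) by (simp add: list_all2_conv_all_nth)
  have sets: "set ys = set xs" "set ws = set us" "length ys = length xs" "length ws = length us"
    "length us = length xs"
    using perm ws(2) us(1) by (auto dest: mset_eq_setD mset_eq_length list_all2_lengthD)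
  have R': "\<forall>\<^sub>F N in sequentially. set (map (\<lambda>u. u N) ws) \<subseteq> R"
    using us(3) by (simp add: sets)
  have L1: "(\<lambda>N. dd f (map (\<lambda>u. u N) us)) \<longlonglongrightarrow> dd f xs"
    by (rule dd_tendsto[OF f len(2,1) R us(1,3)])
  have L2: "(\<lambda>N. dd f (map (\<lambda>u. u N) ws)) \<longlonglongrightarrow> dd f ys"
    by (rule dd_tendsto[OF f _ _ _ ws1 R']) (use len R sets in auto)
  have ev: "\<forall>\<^sub>F N in sequentially. dd f (map (\<lambda>u. u N) us) = dd f (map (\<lambda>u. u N) ws)"
    using us(2,3)
  proof eventually_elim
    case (elim N)
    have m: "mset (map (\<lambda>u. u N) ws) = mset (map (\<lambda>u. u N) us)" using ws(2) by simp
    then have "distinct (map (\<lambda>u. u N) ws)" using elim by (metis mset_eq_imp_distinct_iff)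
    moreover have "set (map (\<lambda>u. u N) ws) = set (map (\<lambda>u. u N) us)" using m by (rule mset_eq_setD)
    ultimately have "diff_quot f (map (\<lambda>u. u N) ws) = diff_quot f (map (\<lambda>u. u N) us)"
      using elim by (intro diff_quot_cong_set)
    moreover have "us \<noteq> []" "ws \<noteq> []" using len(2) sets by auto
    ultimately show ?case
      using elim sets len \<open>distinct (map (\<lambda>u. u N) ws)\<close>
      by (subst (1 2) dd_distinct[OF f]) (auto simp: image_subset_iff)
  qed
  show ?thesis
    by (rule LIMSEQ_unique[OF L2 Lim_transform_eventually[OF L1 ev]])
qed

lemma D_eq_dd: "D v j f x = dd f (replicate (Suc j) x)"
proof -
  have "(\<lambda>i\<in>{..<Suc j}. x) = (\<lambda>i\<in>{..<Suc j}. replicate (Suc j) x ! i)"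
    by (auto simp: restrict_def fun_eq_iff simp del: replicate_Suc)
  then show ?thesis unfolding D_def dd_def by (simp del: replicate_Suc)
qed

end

section \<open>Derivatives of derivatives\<close>

text \<open>\<open>multi_sum h [x\<^sub>1, \<dots>, x\<^sub>k] j\<close> is the sum of \<open>h\<close> over the lists in which each \<open>x\<^sub>i\<close> is
  repeated \<open>1 + \<alpha>\<^sub>i\<close> times, taken over all multi-indices with \<open>\<alpha>\<^sub>1 + \<dots> + \<alpha>\<^sub>k = j\<close>.\<close>

fun multi_sum :: "('b list \<Rightarrow> 'a::comm_monoid_add) \<Rightarrow> 'b list \<Rightarrow> nat \<Rightarrow> 'a" where
  "multi_sum h [] j = (if j = 0 then h [] else 0)"
| "multi_sum h (x # xs) j = (\<Sum>i\<le>j. multi_sum (\<lambda>ys. h (replicate (Suc i) x @ ys)) xs (j - i))"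

lemma multi_sum_cong:
  assumes "\<And>ys. length ys = j + length xs \<Longrightarrow> set ys \<subseteq> set xs \<Longrightarrow> h ys = h' ys"
  shows "multi_sum h xs j = multi_sum h' xs j"
  using assms
proof (induction xs arbitrary: h h' j)
  case (Cons x xs)
  have "multi_sum (\<lambda>ys. h (replicate (Suc i) x @ ys)) xs (j - i) =
      multi_sum (\<lambda>ys. h' (replicate (Suc i) x @ ys)) xs (j - i)" if "i \<le> j" for i
    by (rule Cons.IH, rule Cons.prems) (use that in \<open>auto split: if_splits\<close>)
  then show ?case by simp
qed simp

lemma multi_sum_diff:
  fixes h :: "'b list \<Rightarrow> 'a::ab_group_add"
  shows "multi_sum (\<lambda>ys. h ys - h' ys) xs j = multi_sum h xs j - multi_sum h' xs j"
  by (induction xs arbitrary: h h' j) (simp_all add: sum_subtractf)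

lemma multi_sum_sum:
  "multi_sum (\<lambda>ys. \<Sum>i\<in>A. h i ys) xs j = (\<Sum>i\<in>A. multi_sum (h i) xs j)"
proof (induction xs arbitrary: h j)
  case (Cons x xs)
  then show ?case by (simp add: sum.swap[of _ A])
qed simp

lemma multi_sum_mult_left:
  fixes h :: "'b list \<Rightarrow> 'a::semiring_0"
  shows "multi_sum (\<lambda>ys. c * h ys) xs j = c * multi_sum h xs j"
  by (induction xs arbitrary: h j) (simp_all add: sum_distrib_left)

lemma multi_sum_singleton: "multi_sum h [x] j = h (replicate (Suc j) x)"
proof -
  have "multi_sum h [x] j = (\<Sum>i\<le>j. if i = j then h (replicate (Suc i) x) else 0)"
    by (auto intro!: sum.cong)
  then show ?thesis by simp
qed

text \<open>The coefficient counts multi-indices: there are \<open>(l + j) choose j\<close> ways to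
  write \<open>j\<close> as an ordered sum of \<open>Suc l\<close> natural numbers, and each of them
  presents the same list to \<open>h\<close>.\<close>

lemma multi_sum_replicate:
  fixes h :: "'b list \<Rightarrow> 'a::comm_semiring_1"
  shows "multi_sum h (replicate (Suc l) x) j = of_nat ((l + j) choose j) * h (replicate (Suc (l + j)) x)"
proof (induction l arbitrary: h j)
  case 0
  then show ?case using multi_sum_singleton[of h x j] by simp
next
  case (Suc l)
  have "multi_sum h (replicate (Suc (Suc l)) x) j =
      (\<Sum>i\<le>j. multi_sum (\<lambda>ys. h (replicate (Suc i) x @ ys)) (replicate (Suc l) x) (j - i))"
    by simp
  also have "\<dots> = (\<Sum>i\<le>j. of_nat ((l + (j - i)) choose (j - i)) * h (replicate (Suc (Suc l + j)) x))"
    by (rule sum.cong[OF refl], subst Suc.IH, subst replicate_add[symmetric]) simp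
  also have "\<dots> = of_nat (\<Sum>i\<le>j. (l + (j - i)) choose (j - i)) * h (replicate (Suc (Suc l + j)) x)"
    by (simp only: sum_distrib_right of_nat_sum)
  also have "(\<Sum>i\<le>j. (l + (j - i)) choose (j - i)) = (\<Sum>i\<le>j. (l + i) choose i)"
    by (rule sum.reindex_bij_witness[of _ "\<lambda>i. j - i" "\<lambda>i. j - i"]) auto
  also have "\<dots> = (Suc l + j) choose j" by (simp add: sum_choose_lower)
  finally show ?case .
qed

context local_field
begin

text \<open>Copies of \<open>y\<close> are exchanged for copies of \<open>x\<close> one at a time,
  and each exchange is an instance of \<open>dd_rec\<close>.\<close>

lemma dd_telescope:
  assumes f: "f \<in> C_k v n" and len: "a + 2 + length ys \<le> Suc n" and R: "set (x # y # ys) \<subseteq> R"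
  shows "dd f (replicate (Suc a) x @ ys) - dd f (replicate (Suc a) y @ ys) =
    (x - y) * (\<Sum>i\<le>a. dd f (replicate (Suc i) x @ replicate (Suc (a - i)) y @ ys))"
proof -
  define F where "F i = dd f (replicate i x @ replicate (Suc a - i) y @ ys)" for i
  have "F (Suc i) - F i = (x - y) * dd f (replicate (Suc i) x @ replicate (Suc (a - i)) y @ ys)"
    if i: "i \<le> a" for i
  proof -
    let ?zs = "replicate i x @ replicate (a - i) y @ ys"
    have "F (Suc i) = dd f (x # ?zs)" by (simp add: F_def)
    moreover have "F i = dd f (y # ?zs)"
      unfolding F_def using i len R
      by (intro dd_mset[OF f]) (auto simp: Suc_diff_le split: if_splits)
    moreover have "dd f (replicate (Suc i) x @ replicate (Suc (a - i)) y @ ys) = dd f (x # y # ?zs)"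
      using i len R by (intro dd_mset[OF f]) (auto split: if_splits)
    ultimately show ?thesis
      using i len R by (simp only:, intro dd_rec[OF f]) (auto split: if_splits)
  qed
  then have "(x - y) * (\<Sum>i\<le>a. dd f (replicate (Suc i) x @ replicate (Suc (a - i)) y @ ys)) =
    (\<Sum>i\<le>a. F (Suc i) - F i)"
    unfolding sum_distrib_left by (intro sum.cong) auto
  also have "\<dots> = F (Suc a) - F 0"
    using sum_lessThan_telescope[of F "Suc a"] by (simp add: lessThan_Suc_atMost)
  finally show ?thesis by (simp add: F_def)
qed

text \<open>Telescoping splits the extra multiplicity \<open>a\<close> of the first point into
  \<open>i + k = a\<close>, with \<open>i\<close> for \<open>x\<close> and \<open>k\<close> for
  \<open>y\<close>. Summing over the triangle \<open>i + k \<le> j\<close> is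
  \<open>multi_sum\<close> unfolded at both points.\<close>

lemma multi_sum_dd_rec:
  assumes f: "f \<in> C_k v n" and len: "j + length zs + 2 \<le> Suc n" and R: "set (x # y # zs) \<subseteq> R"
  shows "multi_sum (dd f) (x # zs) j - multi_sum (dd f) (y # zs) j =
    (x - y) * multi_sum (dd f) (x # y # zs) j"
proof -
  define G where "G i k = multi_sum (\<lambda>ys. dd f (replicate (Suc i) x @ replicate (Suc k) y @ ys)) zs (j - (i + k))"
    for i k
  have "multi_sum (dd f) (x # zs) j - multi_sum (dd f) (y # zs) j =
    (\<Sum>a\<le>j. multi_sum (\<lambda>ys. dd f (replicate (Suc a) x @ ys) - dd f (replicate (Suc a) y @ ys)) zs (j - a))"
    by (simp only: multi_sum.simps multi_sum_diff sum_subtractf)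
  also have "\<dots> = (\<Sum>a\<le>j. multi_sum (\<lambda>ys. (x - y) *
      (\<Sum>i\<le>a. dd f (replicate (Suc i) x @ replicate (Suc (a - i)) y @ ys))) zs (j - a))"
    by (intro sum.cong[OF refl] multi_sum_cong dd_telescope[OF f]) (use R len in auto)
  also have "\<dots> = (x - y) * (\<Sum>a\<le>j. \<Sum>i\<le>a. G i (a - i))"
    by (simp only: multi_sum_mult_left multi_sum_sum sum_distrib_left G_def)
      (intro sum.cong[OF refl], simp)
  also have "(\<Sum>a\<le>j. \<Sum>i\<le>a. G i (a - i)) = (\<Sum>(i, k)\<in>{(i, k). i + k \<le> j}. G i k)"
    by (rule sum.triangle_reindex_eq[symmetric])
  also have "\<dots> = (\<Sum>i\<le>j. \<Sum>k\<le>j - i. G i k)"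
    by (subst sum.Sigma) (auto intro!: sum.cong)
  also have "\<dots> = multi_sum (dd f) (x # y # zs) j"
    by (simp only: multi_sum.simps G_def diff_diff_left append.assoc)
  finally show ?thesis .
qed

text \<open>Both sides obey the recursion of difference quotients and agree on single
  points.\<close>

lemma diff_quot_D:
  assumes f: "f \<in> C_k v n" and "distinct xs" "xs \<noteq> []" "j + length xs \<le> Suc n" "set xs \<subseteq> R"
  shows "diff_quot (D v j f) xs = multi_sum (dd f) xs j"
  using assms(2-)
proof (induction "D v j f" xs rule: diff_quot.induct)
  case (2 x)
  then show ?case by (simp only: D_eq_dd multi_sum_singleton diff_quot.simps)
next
  case (3 x y zs)
  have "x - y \<noteq> 0" using "3.prems" by simp
  moreover have "diff_quot (D v j f) (x # zs) = multi_sum (dd f) (x # zs) j"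
    using "3.prems" by (intro "3.hyps") auto
  moreover have "diff_quot (D v j f) (y # zs) = multi_sum (dd f) (y # zs) j"
    using "3.prems" by (intro "3.hyps") auto
  moreover have "multi_sum (dd f) (x # zs) j - multi_sum (dd f) (y # zs) j =
      (x - y) * multi_sum (dd f) (x # y # zs) j"
    using "3.prems" by (intro multi_sum_dd_rec[OF f]) auto
  ultimately show ?case by (metis diff_quot.simps(3) nonzero_mult_div_cancel_left)
qed simp

text \<open>The prefix \<open>ps\<close> collects the blocks already unfolded by
  \<open>multi_sum\<close>; the induction needs it to be arbitrary.\<close>

lemma multi_sum_dd_tendsto:
  assumes f: "f \<in> C_k v n" and "zs @ qs \<noteq> []" and "j + length zs + length qs \<le> Suc n"
    and "set (zs @ qs) \<subseteq> R"
    and "list_all2 (\<lambda>u z. (u \<longlongrightarrow> z) F) us zs" and "list_all2 (\<lambda>u z. (u \<longlongrightarrow> z) F) ps qs"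
    and "\<forall>\<^sub>F p in F. set (map (\<lambda>u. u p) (us @ ps)) \<subseteq> R"
  shows "((\<lambda>p. multi_sum (\<lambda>ys. dd f (map (\<lambda>u. u p) ps @ ys)) (map (\<lambda>u. u p) us) j) \<longlongrightarrow>
    multi_sum (\<lambda>ys. dd f (qs @ ys)) zs j) F"
  using assms(2-)
proof (induction zs arbitrary: us ps qs j)
  case Nil
  then show ?case by (auto intro!: dd_tendsto[OF f])
next
  case (Cons z zs)
  then obtain u us' where us: "us = u # us'" "(u \<longlongrightarrow> z) F" "list_all2 (\<lambda>u z. (u \<longlongrightarrow> z) F) us' zs"
    by (auto simp: list_all2_Cons2)
  have "((\<lambda>p. multi_sum (\<lambda>ys. dd f (map (\<lambda>u. u p) (ps @ replicate (Suc i) u) @ ys)) (map (\<lambda>u. u p) us') (j - i)) \<longlongrightarrow>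
    multi_sum (\<lambda>ys. dd f ((qs @ replicate (Suc i) z) @ ys)) zs (j - i)) F" if "i \<le> j" for i
  proof (rule Cons.IH)
    show "\<forall>\<^sub>F p in F. set (map (\<lambda>u. u p) (us' @ ps @ replicate (Suc i) u)) \<subseteq> R"
      using Cons.prems(6) by eventually_elim (auto simp: us)
    show "list_all2 (\<lambda>u z. (u \<longlongrightarrow> z) F) (ps @ replicate (Suc i) u) (qs @ replicate (Suc i) z)"
      using Cons.prems(5) us(2)
      by (intro list_all2_appendI) (auto simp: list_all2_conv_all_nth simp del: replicate_Suc)
  qed (use Cons.prems that us(3) in auto)
  then show ?case
    by (simp only: us multi_sum.simps list.map map_append map_replicate append.assoc)
      (intro tendsto_lf_sum, simp)
qed

text \<open>The right-hand side of \<open>diff_quot_D\<close> makes sense and is continuous on all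
  tuples, so it is the extension in explicit form. In particular \<open>D v j f\<close> is in
  \<open>C_k v (n - j)\<close>.\<close>

lemma extends_Phi_D:
  assumes f: "f \<in> C_k v n" and lj: "l + j \<le> n"
  shows "extends_Phi v l (D v j f) (tuples v (Suc l)) (\<lambda>x. multi_sum (dd f) (map x [0..<Suc l]) j)"
  unfolding extends_Phi_def continuous_on_def
proof (intro conjI ballI)
  fix z assume z: "z \<in> tuples v (Suc l)"
  let ?F = "at z within tuples v (Suc l)"
  let ?us = "map (\<lambda>i x. x i) [0..<Suc l]"
  have "((\<lambda>x. x) \<longlongrightarrow> z) ?F" by simp
  then have comp: "((\<lambda>x. x i) \<longlongrightarrow> z i) ?F" for i by (rule tendsto_fun_component)
  have *: "map (\<lambda>u. u x) ?us = map x [0..<Suc l]" for x :: "nat \<Rightarrow> 'a"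
    by (simp add: comp_def)
  have "((\<lambda>x. multi_sum (\<lambda>ys. dd f (map (\<lambda>u. u x) [] @ ys)) (map (\<lambda>u. u x) ?us) j) \<longlongrightarrow>
    multi_sum (\<lambda>ys. dd f ([] @ ys)) (map z [0..<Suc l]) j) ?F"
  proof (rule multi_sum_dd_tendsto[OF f])
    show "set (map z [0..<Suc l] @ []) \<subseteq> R" unfolding append_Nil2 by (rule set_map_tuple[OF z]) auto
    show "list_all2 (\<lambda>u z. (u \<longlongrightarrow> z) ?F) ?us (map z [0..<Suc l])"
      using comp by (simp add: list_all2_conv_all_nth del: upt_Suc)
    show "\<forall>\<^sub>F p in ?F. set (map (\<lambda>u. u p) (?us @ [])) \<subseteq> R"
      unfolding eventually_at_filter append_Nil2 *
      by (intro always_eventually allI impI, rule set_map_tuple[of _ "Suc l"]) auto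
  qed (use lj in auto)
  then show "((\<lambda>x. multi_sum (dd f) (map x [0..<Suc l]) j) \<longlongrightarrow> multi_sum (dd f) (map z [0..<Suc l]) j) ?F"
    by (simp only: * list.map append_Nil)
next
  fix x assume x: "x \<in> distinct_tuples v (Suc l)"
  have "inj_on x (set [0..<Suc l])" using x by (simp add: distinct_tuples_def atLeast0LessThan del: upt_Suc)
  then have "distinct (map x [0..<Suc l])" by (simp add: distinct_map del: upt_Suc)
  then show "multi_sum (dd f) (map x [0..<Suc l]) j = Phi l (D v j f) x"
    unfolding Phi_def
    using x distinct_tuples_subset lj
    by (intro diff_quot_D[OF f, symmetric] set_map_tuple[of _ "Suc l"]) auto
qed

text \<open>On the diagonal the explicit extension collapses by \<open>multi_sum_replicate\<close>.
  With \<open>c\<close> in the role of a derivative of order \<open>n + 1\<close>, the same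
  coefficient explains the factor \<open>(n + 1) choose j\<close> in the hypothesis of the
  theorem.\<close>

lemma D_D:
  assumes f: "f \<in> C_k v n" and lj: "l + j \<le> n" and x: "x \<in> R"
  shows "D v l (D v j f) x = of_nat ((l + j) choose j) * D v (l + j) f x"
proof -
  let ?z = "\<lambda>i\<in>{..<Suc l}. x"
  have "?z \<in> tuples v (Suc l)" using x by (auto simp: tuples_def)
  then have "D v l (D v j f) x = multi_sum (dd f) (map ?z [0..<Suc l]) j"
    unfolding D_def[of v l]
    by (intro extends_Phi_unique[OF extends_Phi_ext[OF extends_Phi_D[OF f lj]] extends_Phi_D[OF f lj]
          distinct_tuples_subset]) auto
  also have "map ?z [0..<Suc l] = replicate (Suc l) x"
    by (rule nth_equalityI) (auto simp del: upt_Suc replicate_Suc)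
  finally show ?thesis by (simp only: multi_sum_replicate D_eq_dd[of "l + j" f])
qed

lemma D_tendsto:
  assumes f: "f \<in> C_k v n" and j: "j \<le> n" and u: "(u \<longlongrightarrow> x) F" and R: "x \<in> R" "\<And>p. u p \<in> R"
  shows "((\<lambda>p. D v j f (u p)) \<longlongrightarrow> D v j f x) F"
proof -
  have "((\<lambda>p. dd f (map (\<lambda>u. u p) (replicate (Suc j) u))) \<longlongrightarrow> dd f (replicate (Suc j) x)) F"
    by (intro dd_tendsto[OF f])
      (use j R in \<open>auto simp: list_all2_conv_all_nth u simp del: replicate_Suc\<close>)
  then show ?thesis by (simp only: D_eq_dd map_replicate)
qed

section \<open>Divided differences of order n + 1 away from the diagonal\<close>

lemma distinct_tuples_off_diagonal:
  "distinct_tuples v (Suc (n + 1)) \<subseteq> tuples v (n + 2) - diagonal v (n + 2)"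
proof
  fix x assume x: "x \<in> distinct_tuples v (Suc (n + 1))"
  have "inj_on x {..<n + 2}" using x by (simp add: distinct_tuples_def)
  then have "x 0 \<noteq> x 1" by (auto simp: inj_on_def)
  then have "x \<notin> diagonal v (n + 2)" by (auto simp: diagonal_def)
  then show "x \<in> tuples v (n + 2) - diagonal v (n + 2)"
    using x distinct_tuples_subset by auto
qed

text \<open>Off the diagonal some coordinate differs from coordinate 0. With these two moved to the
  front, the recursion divides by a difference with nonzero limit, and its numerator involves only
  lists of \<open>n + 1\<close> entries, on which \<open>dd f\<close> is continuous.\<close>

lemma extends_Phi_off_diagonal:
  assumes f: "f \<in> C_k v n"
  shows "\<exists>g. extends_Phi v (n + 1) f (tuples v (n + 2) - diagonal v (n + 2)) g"
proof (rule extends_Phi_exI)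
  show "distinct_tuples v (Suc (n + 1)) \<subseteq> tuples v (n + 2) - diagonal v (n + 2)"
    by (rule distinct_tuples_off_diagonal)
next
  fix z assume zz: "z \<in> tuples v (n + 2) - diagonal v (n + 2)"
  then have z: "z \<in> tuples v (n + 2)" by blast
  let ?F = "inf (nhds z) (principal (distinct_tuples v (Suc (n + 1))))"
  have "\<exists>i<n + 2. z i \<noteq> z 0"
  proof (rule ccontr)
    assume const: "\<not> (\<exists>i<n + 2. z i \<noteq> z 0)"
    have "z \<in> extensional {..<n + 2}" using z by (simp add: tuples_def PiE_def)
    then have "z = (\<lambda>i\<in>{..<n + 2}. z 0)"
    proof (rule extensionalityI)
      fix k assume k: "k \<in> {..<n + 2}"
      then have "z k = z 0" using const by blast
      then show "z k = (\<lambda>i\<in>{..<n + 2}. z 0) k" using k by (simp only: restrict_apply if_True)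
    qed simp
    moreover have "z 0 \<in> R" using z by (rule tuples_mem) simp
    ultimately have "z \<in> diagonal v (n + 2)"
      unfolding diagonal_def by (intro CollectI exI conjI)
    then show False using zz by blast
  qed
  then obtain i where i: "i < n + 2" "z i \<noteq> z 0" by blast
  then have i0: "i \<noteq> 0" by (cases i) auto
  define "is" where "is = filter (\<lambda>k. k \<noteq> i \<and> k \<noteq> 0) [0..<n + 2]"
  have dist: "distinct (i # 0 # is)" and set: "set (i # 0 # is) = {..<n + 2}"
    using i i0 by (auto simp: is_def)
  have "length (i # 0 # is) = n + 2" using distinct_card[OF dist] set by simp
  then have len: "length is = n" by simp
  have comp: "((\<lambda>x. x k) \<longlongrightarrow> z k) ?F" for k by (rule tendsto_inf_principal_component)
  have ev: "\<forall>\<^sub>F x in ?F. distinct (map x (i # 0 # is)) \<and> set (map x (i # 0 # is)) \<subseteq> R"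
    using eventually_inf_principal_distinct[OF dist equalityD1[OF set]] by simp
  have ev': "\<forall>\<^sub>F x in ?F. distinct (map x [0..<n + 2]) \<and> set (map x [0..<n + 2]) \<subseteq> R"
    using eventually_inf_principal_distinct[of "[0..<n + 2]" "n + 2" z] by (simp add: atLeast0LessThan)
  have lim: "((\<lambda>x. dd f (map x ks)) \<longlongrightarrow> dd f (map z ks)) ?F"
    if ks: "ks = i # is \<or> ks = 0 # is" for ks
  proof -
    let ?us = "map (\<lambda>k x. x k) ks"
    have *: "map (\<lambda>u. u x) ?us = map x ks" for x :: "nat \<Rightarrow> 'a"
      by (simp add: comp_def)
    have "((\<lambda>x. dd f (map (\<lambda>u. u x) ?us)) \<longlongrightarrow> dd f (map z ks)) ?F"
    proof (rule dd_tendsto[OF f])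
      have "set ks \<subseteq> set (i # 0 # is)" using ks by auto
      then show "set (map z ks) \<subseteq> R" unfolding set by (rule set_map_tuple[OF z])
      show "list_all2 (\<lambda>u z. (u \<longlongrightarrow> z) ?F) ?us (map z ks)"
        using comp by (simp add: list_all2_conv_all_nth)
      show "\<forall>\<^sub>F p in ?F. set (map (\<lambda>u. u p) ?us) \<subseteq> R"
        unfolding * using ev
      proof eventually_elim
        case (elim p)
        have "set (map p ks) \<subseteq> set (map p (i # 0 # is))" using ks by auto
        with elim show ?case by blast
      qed
    qed (use ks len in auto)
    then show ?thesis by (simp only: *)
  qed
  have "((\<lambda>x. (dd f (map x (i # is)) - dd f (map x (0 # is))) / (x i - x 0)) \<longlongrightarrow>
    (dd f (map z (i # is)) - dd f (map z (0 # is))) / (z i - z 0)) ?F"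
    using i by (intro tendsto_lf_divide tendsto_lf_diff lim comp) auto
  then have "(Phi (n + 1) f \<longlongrightarrow> (dd f (map z (i # is)) - dd f (map z (0 # is))) / (z i - z 0)) ?F"
  proof (rule Lim_transform_eventually)
    show "\<forall>\<^sub>F x in ?F. (dd f (map x (i # is)) - dd f (map x (0 # is))) / (x i - x 0) = Phi (n + 1) f x"
      using ev ev'
    proof eventually_elim
      case (elim x)
      have "Phi (n + 1) f x = diff_quot f (map x (i # 0 # is))"
        unfolding Phi_def
      proof (rule diff_quot_cong_set)
        show "set (map x [0..<Suc (n + 1)]) = set (map x (i # 0 # is))"
          unfolding set_map set by (simp add: atLeast0LessThan del: upt_Suc)
      qed (use elim in auto)
      moreover have "dd f (map x (i # is)) = diff_quot f (map x (i # is))"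
        "dd f (map x (0 # is)) = diff_quot f (map x (0 # is))"
        using elim len by (intro dd_distinct[OF f]; auto simp: image_subset_iff)+
      ultimately show ?case by simp
    qed
  qed
  then show "\<exists>l. (Phi (n + 1) f \<longlongrightarrow> l) ?F" by blast
qed auto

lemma psi2_eq:
  assumes f: "f \<in> C_k v n" and R: "x \<in> R" "y \<in> R" and xy: "x \<noteq> y" and im: "i + m = n"
  shows "(x - y) * psi2 v n (Suc i) f x y =
    dd f (replicate (Suc i) x @ replicate m y) - dd f (replicate i x @ replicate (Suc m) y)"
proof -
  let ?S = "tuples v (n + 2) - diagonal v (n + 2)"
  obtain g where "extends_Phi v (n + 1) f ?S g" using extends_Phi_off_diagonal[OF f] by blast
  then have ext: "extends_Phi v (n + 1) f ?S (Phi_ext v (n + 1) f ?S)" by (rule extends_Phi_ext)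
  \<comment> \<open>One \<open>x\<close> and one \<open>y\<close> are split off from their blocks,
    because the recursion is applied to exactly these two entries.\<close>
  define zs where "zs = x # replicate i x @ y # replicate m y"
  have len: "length zs = n + 2" using im by (simp add: zs_def)
  have zR: "set zs \<subseteq> R" using R by (auto simp: zs_def)
  have tup: "tup zs = (\<lambda>k\<in>{..<n + 2}. if k < Suc i then x else y)"
  proof -
    have "zs ! k = (if k < Suc i then x else y)" if "k < n + 2" for k
    proof -
      have "zs = replicate (Suc i) x @ replicate (Suc m) y" by (simp add: zs_def)
      then show ?thesis using that im by (simp add: nth_append del: replicate_Suc)
    qed
    then show ?thesis by (simp add: len restrict_def fun_eq_iff)
  qed
  have "tup zs \<notin> diagonal v (n + 2)"
  proof
    assume "tup zs \<in> diagonal v (n + 2)"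
    then obtain w where w: "tup zs = (\<lambda>i\<in>{..<n + 2}. w)" by (auto simp: diagonal_def)
    have "tup zs 0 = x" "tup zs (Suc i) = y" unfolding tup using im by auto
    then show False using xy im unfolding w by auto
  qed
  then have zS: "tup zs \<in> ?S" using tup_in_tuples[OF zR len] by blast
  have dS: "distinct_tuples v (Suc (n + 1)) \<subseteq> ?S"
    by (rule distinct_tuples_off_diagonal)
  obtain us where us: "list_all2 (\<lambda>u z. u \<longlonglongrightarrow> z) us zs"
    "\<forall>\<^sub>F N in sequentially. distinct (map (\<lambda>u. u N) us)"
    "\<forall>\<^sub>F N in sequentially. set (map (\<lambda>u. u N) us) \<subseteq> R"
    by (rule distinct_approximation[OF zR])
  obtain a as b bs where u: "us = a # as @ b # bs" and lims: "a \<longlonglongrightarrow> x"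
    "list_all2 (\<lambda>u z. u \<longlonglongrightarrow> z) as (replicate i x)" "b \<longlonglongrightarrow> y"
    "list_all2 (\<lambda>u z. u \<longlonglongrightarrow> z) bs (replicate m y)"
    using us(1) unfolding zs_def list_all2_Cons2 list_all2_append2 by blast
  have lab: "length as = i" "length bs = m" using lims by (auto dest: list_all2_lengthD)
  have len': "length zs = Suc (n + 1)" using len by simp
  have L1: "(\<lambda>N. (a N - b N) * diff_quot f (map (\<lambda>u. u N) us)) \<longlonglongrightarrow> (x - y) * psi2 v n (Suc i) f x y"
    using extends_Phi_tendsto_distinct[OF ext dS zS len' us] lims
    unfolding psi2_def tup by (intro tendsto_lf_mult tendsto_lf_diff)
  have *: "(\<lambda>N. dd f (map (\<lambda>u. u N) ws)) \<longlonglongrightarrow> dd f ys"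
    if "ys \<noteq> []" "length ys \<le> Suc n" "set ys \<subseteq> R" "set ws \<subseteq> set us" "list_all2 (\<lambda>u z. u \<longlonglongrightarrow> z) ws ys"
    for ys ws
  proof (rule dd_tendsto[OF f])
    show "\<forall>\<^sub>F N in sequentially. set (map (\<lambda>u. u N) ws) \<subseteq> R"
      using us(3) by eventually_elim (use that(4) in auto)
  qed (use that in auto)
  have "list_all2 (\<lambda>u z. u \<longlonglongrightarrow> z) (as @ b # bs) (replicate i x @ y # replicate m y)"
    "list_all2 (\<lambda>u z. u \<longlonglongrightarrow> z) (a # as @ bs) (x # replicate i x @ replicate m y)"
    using lims by (auto intro!: list_all2_appendI)
  then have L2: "(\<lambda>N. dd f (map (\<lambda>u. u N) (a # as @ bs)) - dd f (map (\<lambda>u. u N) (as @ b # bs))) \<longlonglongrightarrow>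
     dd f (x # replicate i x @ replicate m y) - dd f (replicate i x @ y # replicate m y)"
    using R im by (intro tendsto_lf_diff *) (auto simp: u)
  have ev: "\<forall>\<^sub>F N in sequentially. dd f (map (\<lambda>u. u N) (a # as @ bs)) - dd f (map (\<lambda>u. u N) (as @ b # bs))
     = (a N - b N) * diff_quot f (map (\<lambda>u. u N) us)"
    using us(2,3)
  proof eventually_elim
    case (elim N)
    let ?as = "map (\<lambda>u. u N) as" and ?bs = "map (\<lambda>u. u N) bs"
    have d: "distinct (a N # ?as @ b N # ?bs)" and r: "set (a N # ?as @ b N # ?bs) \<subseteq> R"
      using elim by (auto simp: u)
    have "diff_quot f (map (\<lambda>u. u N) us) = diff_quot f (a N # b N # ?as @ ?bs)"
      using d by (intro diff_quot_cong_set) (auto simp: u)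
    moreover have "dd f (a N # ?as @ ?bs) = diff_quot f (a N # ?as @ ?bs)"
      using d r lab im by (intro dd_distinct[OF f]) (auto simp: image_subset_iff)
    moreover have "dd f (?as @ b N # ?bs) = diff_quot f (?as @ b N # ?bs)"
      using d r lab im by (intro dd_distinct[OF f]) (auto simp: image_subset_iff)
    moreover have "diff_quot f (?as @ b N # ?bs) = diff_quot f (b N # ?as @ ?bs)"
      using d by (intro diff_quot_cong_set) auto
    moreover have "a N \<noteq> b N" using d by auto
    ultimately show ?case by simp
  qed
  show ?thesis
    using LIMSEQ_unique[OF L1 Lim_transform_eventually[OF L2 ev]] by simp
qed

end

section \<open>Taylor remainders\<close>

text \<open>Terms with \<open>l < j\<close> vanish because of the binomial coefficient.\<close>

definition taylor_rem :: "(nat \<Rightarrow> 'a \<Rightarrow> 'a) \<Rightarrow> nat \<Rightarrow> nat \<Rightarrow> 'a \<Rightarrow> 'a \<Rightarrow> 'a::comm_ring_1" where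
  "taylor_rem d N j x y = d j x - (\<Sum>l\<le>N. of_nat (l choose j) * (x - y) ^ (l - j) * d l y)"

text \<open>The identity \<open>(m choose l) * (l choose j) = (m choose j) * ((m - j) choose (l -
  j))\<close> reduces this to the binomial theorem. For \<open>j > m\<close> every term contains a
  zero binomial coefficient.\<close>

lemma sum_choose_mult_powers:
  fixes x y :: "'a::comm_ring_1"
  assumes "m \<le> N"
  shows "(\<Sum>l\<le>N. of_nat (l choose j) * x ^ (l - j) * (of_nat (m choose l) * y ^ (m - l))) =
    of_nat (m choose j) * (x + y) ^ (m - j)"
proof (cases "j \<le> m")
  case True
  have "(\<Sum>l\<le>N. of_nat (l choose j) * x ^ (l - j) * (of_nat (m choose l) * y ^ (m - l))) =
    (\<Sum>l\<in>{j..m}. of_nat (l choose j) * x ^ (l - j) * (of_nat (m choose l) * y ^ (m - l)))"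
    using assms by (intro sum.mono_neutral_right) (auto simp: not_le binomial_eq_0)
  also have "\<dots> = (\<Sum>k\<le>m - j. of_nat (m choose j) * (of_nat ((m - j) choose k) * x ^ k * y ^ (m - j - k)))"
  proof (rule sum.reindex_bij_witness[of _ "\<lambda>k. k + j" "\<lambda>l. l - j"])
    fix l assume l: "l \<in> {j..m}"
    have "(m choose l) * (l choose j) = (m choose j) * ((m - j) choose (l - j))"
      using l by (intro choose_mult) auto
    then have *: "(of_nat (m choose j) * of_nat ((m - j) choose (l - j)) :: 'a) =
      of_nat (m choose l) * of_nat (l choose j)"
      by (metis of_nat_mult)
    have exp: "m - j - (l - j) = m - l" using l by auto
    show "of_nat (m choose j) * (of_nat ((m - j) choose (l - j)) * x ^ (l - j) * y ^ (m - j - (l - j))) =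
      of_nat (l choose j) * x ^ (l - j) * (of_nat (m choose l) * y ^ (m - l))"
      unfolding exp mult.assoc[symmetric] * by (simp only: mult_ac)
  qed (use True in auto)
  also have "\<dots> = of_nat (m choose j) * (x + y) ^ (m - j)"
    by (simp add: binomial_ring sum_distrib_left)
  finally show ?thesis .
next
  case False
  then have "(m choose l) * (l choose j) = 0" for l by (cases "l \<le> m") (auto simp: binomial_eq_0)
  then have *: "(m choose l) = 0 \<or> (l choose j) = 0" for l by simp
  have "(\<Sum>l\<le>N. of_nat (l choose j) * x ^ (l - j) * (of_nat (m choose l) * y ^ (m - l))) = 0"
  proof (intro sum.neutral ballI)
    fix l show "of_nat (l choose j) * x ^ (l - j) * (of_nat (m choose l) * y ^ (m - l)) = 0"
      using *[of l] by (elim disjE) (simp_all only: of_nat_0 mult_zero_left mult_zero_right)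
  qed
  then show ?thesis using False by (simp add: binomial_eq_0)
qed

text \<open>Re-expanding the polynomial centred at \<open>z\<close> about \<open>y\<close> is exact,
  by \<open>sum_choose_mult_powers\<close>. What remains is the error of the coefficients at
  \<open>y\<close>, propagated to \<open>x\<close>.\<close>

lemma taylor_rem_cocycle:
  "taylor_rem d N j x z = taylor_rem d N j x y +
    (\<Sum>l\<le>N. of_nat (l choose j) * (x - y) ^ (l - j) * taylor_rem d N l y z)"
proof -
  have "(\<Sum>l\<le>N. of_nat (l choose j) * (x - y) ^ (l - j) *
      (\<Sum>m\<le>N. of_nat (m choose l) * (y - z) ^ (m - l) * d m z)) =
    (\<Sum>m\<le>N. (\<Sum>l\<le>N. of_nat (l choose j) * (x - y) ^ (l - j) * (of_nat (m choose l) * (y - z) ^ (m - l))) * d m z)"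
    unfolding sum_distrib_left sum_distrib_right by (subst sum.swap) (simp only: mult.assoc)
  also have "\<dots> = (\<Sum>m\<le>N. of_nat (m choose j) * (x - z) ^ (m - j) * d m z)"
    by (intro sum.cong refl, subst sum_choose_mult_powers) auto
  finally show ?thesis
    unfolding taylor_rem_def by (simp add: right_diff_distrib sum_subtractf)
qed

lemma taylor_rem_self: assumes "j \<le> N" shows "taylor_rem d N j x x = 0"
proof -
  have "of_nat (l choose j) * (x - x) ^ (l - j) * d l x = 0" if "l \<noteq> j" for l
    using that by (cases "l < j") (auto simp: binomial_eq_0 zero_power)
  then have "(\<Sum>l\<le>N. of_nat (l choose j) * (x - x) ^ (l - j) * d l x) = (\<Sum>l\<in>{j}. d l x)"
    using assms by (intro sum.mono_neutral_cong_right) auto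
  then show ?thesis by (simp add: taylor_rem_def)
qed

lemma taylor_rem_top: "taylor_rem d N N x y = d N x - d N y"
proof -
  have "(\<Sum>l\<le>N. of_nat (l choose N) * (x - y) ^ (l - N) * d l y) = (\<Sum>l\<in>{N}. d l y)"
    by (intro sum.mono_neutral_cong_right) (auto simp: binomial_eq_0)
  then show ?thesis by (simp add: taylor_rem_def)
qed

text \<open>A finite expansion is encoded as a truncation of an infinite digit sequence, so dropping
  digits only changes \<open>k\<close>.\<close>

definition partial_expansion :: "'a::comm_ring_1 \<Rightarrow> (nat \<Rightarrow> 'a) \<Rightarrow> nat \<Rightarrow> 'a" where
  "partial_expansion \<pi> a k = (\<Sum>i<k. a i * \<pi> ^ i)"

lemma partial_expansion_Suc:
  "partial_expansion \<pi> a (Suc k) = partial_expansion \<pi> a k + a k * \<pi> ^ k"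
  by (simp add: partial_expansion_def)

lemma partial_expansion_cong:
  "(\<And>i. i < k \<Longrightarrow> a i = b i) \<Longrightarrow> partial_expansion \<pi> a k = partial_expansion \<pi> b k"
  by (simp add: partial_expansion_def)

text \<open>\<open>poly_dd d N x y i m\<close> is the divided difference of the polynomial
  \<open>\<Sum>l\<le>N. d l y * (X - y) ^ l\<close> at \<open>x\<close> repeated \<open>i\<close> times and \<open>y\<close> repeated \<open>m\<close> times.\<close>

fun poly_dd :: "(nat \<Rightarrow> 'a \<Rightarrow> 'a) \<Rightarrow> nat \<Rightarrow> 'a \<Rightarrow> 'a \<Rightarrow> nat \<Rightarrow> nat \<Rightarrow> 'a::comm_ring_1" where
  "poly_dd d N x y 0 m = d (m - 1) y"
| "poly_dd d N x y (Suc i) m = (\<Sum>k\<le>N - m. of_nat (k choose i) * (x - y) ^ (k - i) * d (m + k) y)"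

lemma poly_dd_rec:
  assumes "m < N"
  shows "(x - y) * poly_dd d N x y (Suc i) (Suc m) = poly_dd d N x y (Suc i) m - poly_dd d N x y i (Suc m)"
proof -
  obtain L where L: "N - m = Suc L" "N - Suc m = L" using assms by (cases "N - m") auto
  \<comment> \<open>Splitting off \<open>k = 0\<close> aligns the coefficients
    \<open>d (Suc m + k) y\<close> of the sums. The separated term is nonzero only for
    \<open>i = 0\<close>, where it cancels against \<open>poly_dd d N x y 0 (Suc m)\<close>.\<close>
  have shift: "poly_dd d N x y (Suc i) m = of_nat (0 choose i) * d m y +
    (\<Sum>k\<le>L. of_nat (Suc k choose i) * (x - y) ^ (Suc k - i) * d (Suc m + k) y)"
    by (simp add: L sum.atMost_Suc_shift del: sum.atMost_Suc binomial_Suc_Suc)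
  show ?thesis
  proof (cases i)
    case 0
    show ?thesis unfolding shift unfolding 0 by (simp add: L sum_distrib_left mult.assoc)
  next
    case (Suc i')
    \<comment> \<open>Pascal's rule multiplied by a power of \<open>t\<close>; the case
      \<open>i > k\<close> is separate because exponents are truncated differences.\<close>
    have pascal: "t * (of_nat (k choose i) * t ^ (k - i) * e) =
      of_nat (Suc k choose i) * t ^ (Suc k - i) * e - of_nat (k choose i') * t ^ (k - i') * e"
      for k and t e :: 'a
    proof (cases "i \<le> k")
      case True
      then have "t ^ (k - i') = t * t ^ (k - i)"
        unfolding Suc by (metis Suc_diff_Suc Suc_le_lessD power_Suc)
      then show ?thesis by (simp add: Suc algebra_simps)
    qed (simp add: Suc binomial_eq_0 not_le algebra_simps)
    have "(x - y) * poly_dd d N x y (Suc i) (Suc m) =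
      (\<Sum>k\<le>L. (x - y) * (of_nat (k choose i) * (x - y) ^ (k - i) * d (Suc m + k) y))"
      by (simp only: poly_dd.simps L sum_distrib_left)
    then show ?thesis
      unfolding shift pascal unfolding Suc by (simp add: L sum_subtractf del: binomial_Suc_Suc)
  qed
qed

text \<open>A polynomial of degree at most \<open>N\<close> has constant divided differences of
  order \<open>N\<close>, equal to its coefficient of degree \<open>N\<close>.\<close>

lemma poly_dd_top:
  assumes "Suc (i + m) = N"
  shows "poly_dd d N x y (Suc i) (Suc m) = d N y"
proof -
  have "N - Suc m = i" using assms by auto
  moreover have "(\<Sum>k\<le>i. of_nat (k choose i) * (x - y) ^ (k - i) * d (Suc m + k) y) = (\<Sum>k\<in>{i}. d (Suc m + k) y)"
    by (intro sum.mono_neutral_cong_right) (auto simp: binomial_eq_0)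
  ultimately show ?thesis using assms by (simp add: add.commute)
qed

section \<open>Closeness of Taylor polynomials at a fixed scale\<close>

context local_field
begin

text \<open>The weights are chosen so that re-expansion about a point at distance at most \<rho>
  preserves them: it multiplies the error of index \<open>l\<close> by at most
  \<open>\<rho> ^ (l - j)\<close>, and \<open>\<rho> ^ (l - j) * \<rho> ^ (N - l)\<close> is again
  the weight of index \<open>j\<close>.\<close>

definition taylor_close :: "(nat \<Rightarrow> 'a \<Rightarrow> 'a) \<Rightarrow> nat \<Rightarrow> real \<Rightarrow> real \<Rightarrow> 'a \<Rightarrow> 'a \<Rightarrow> bool" where
  "taylor_close d N \<epsilon> \<rho> x y \<longleftrightarrow> (\<forall>j\<le>N. av (taylor_rem d N j x y) < \<epsilon> * \<rho> ^ (N - j))"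

lemma taylor_close_refl: "\<epsilon> > 0 \<Longrightarrow> \<rho> > 0 \<Longrightarrow> taylor_close d N \<epsilon> \<rho> x x"
  by (simp add: taylor_close_def taylor_rem_self)

lemma taylor_close_mono:
  assumes "taylor_close d N \<epsilon> \<rho> x y" "0 \<le> \<rho>" "\<rho> \<le> \<rho>'" "\<epsilon> > 0"
  shows "taylor_close d N \<epsilon> \<rho>' x y"
  unfolding taylor_close_def
proof (intro allI impI)
  fix j assume "j \<le> N"
  then have "av (taylor_rem d N j x y) < \<epsilon> * \<rho> ^ (N - j)" using assms(1) by (simp add: taylor_close_def)
  also have "\<dots> \<le> \<epsilon> * \<rho>' ^ (N - j)" using assms by (intro mult_left_mono power_mono) auto
  finally show "av (taylor_rem d N j x y) < \<epsilon> * \<rho>' ^ (N - j)" .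
qed

lemma taylor_close_shift:
  assumes yz: "taylor_close d N \<epsilon> \<rho> y z" and xy: "av (x - y) \<le> \<rho>" and pos: "\<epsilon> > 0" "\<rho> > 0" and j: "j \<le> N"
  shows "av (\<Sum>l\<le>N. of_nat (l choose j) * (x - y) ^ (l - j) * taylor_rem d N l y z) < \<epsilon> * \<rho> ^ (N - j)"
proof (rule av_sum_less)
  fix l assume l: "l \<in> {..N}"
  show "av (of_nat (l choose j) * (x - y) ^ (l - j) * taylor_rem d N l y z) < \<epsilon> * \<rho> ^ (N - j)"
  proof (cases "j \<le> l")
    case True
    have "av (of_nat (l choose j) * (x - y) ^ (l - j)) \<le> 1 * \<rho> ^ (l - j)"
      unfolding av_mult av_power using pos xy
      by (intro mult_mono power_mono av_of_nat_le) auto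
    then have "av (of_nat (l choose j) * (x - y) ^ (l - j) * taylor_rem d N l y z) \<le>
      \<rho> ^ (l - j) * av (taylor_rem d N l y z)"
      unfolding av_mult[of _ "taylor_rem d N l y z"] by (intro mult_right_mono) auto
    also have "\<dots> < \<rho> ^ (l - j) * (\<epsilon> * \<rho> ^ (N - l))"
      using yz l pos by (intro mult_strict_left_mono) (auto simp: taylor_close_def)
    also have "\<dots> = \<epsilon> * \<rho> ^ (N - j)"
      using True l by (simp flip: power_add)
    finally show ?thesis .
  qed (use pos in \<open>simp add: binomial_eq_0 not_le\<close>)
qed (use pos in simp)

lemma taylor_close_trans:
  assumes "taylor_close d N \<epsilon> \<rho> x y" "taylor_close d N \<epsilon> \<rho> y z" "av (x - y) \<le> \<rho>" "\<epsilon> > 0" "\<rho> > 0"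
  shows "taylor_close d N \<epsilon> \<rho> x z"
  unfolding taylor_close_def
proof (intro allI impI)
  fix j assume j: "j \<le> N"
  show "av (taylor_rem d N j x z) < \<epsilon> * \<rho> ^ (N - j)"
    unfolding taylor_rem_cocycle[of d N j x z y]
    using assms(1) j by (intro av_add_less taylor_close_shift assms(2-5) j) (simp add: taylor_close_def)
qed

lemma taylor_close_sym:
  assumes "taylor_close d N \<epsilon> \<rho> x y" "av (x - y) \<le> \<rho>" "\<epsilon> > 0" "\<rho> > 0"
  shows "taylor_close d N \<epsilon> \<rho> y x"
  unfolding taylor_close_def
proof (intro allI impI)
  fix j assume j: "j \<le> N"
  \<comment> \<open>The cocycle along \<open>y\<close>, \<open>x\<close>, \<open>y\<close> has
    left-hand side 0.\<close>
  have "taylor_rem d N j y x = - (\<Sum>l\<le>N. of_nat (l choose j) * (y - x) ^ (l - j) * taylor_rem d N l x y)"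
    using taylor_rem_cocycle[of d N j y y x] taylor_rem_self[OF j, of d y] by (simp add: eq_neg_iff_add_eq_0)
  moreover have "av (y - x) \<le> \<rho>" using assms(2) by (simp add: av_diff_commute)
  ultimately show "av (taylor_rem d N j y x) < \<epsilon> * \<rho> ^ (N - j)"
    using taylor_close_shift[OF assms(1) _ assms(3,4) j] by simp
qed

text \<open>Think of \<open>A i m\<close> as the divided difference at \<open>i\<close> copies of
  \<open>x\<close> and \<open>m\<close> copies of \<open>y\<close>. Subtracting
  \<open>poly_dd\<close> leaves a table \<open>?Z\<close> with the same recursion, zero for
  \<open>i = 0\<close> and made of Taylor remainders for \<open>m = 0\<close>. Each use of the
  recursion divides by \<open>x - y\<close> and costs one power of \<open>av (x - y)\<close>; at
  \<open>n + 2\<close> points the exponent has dropped to 0.\<close>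

lemma divided_difference_bound:
  fixes A :: "nat \<Rightarrow> nat \<Rightarrow> 'a"
  assumes xy: "x \<noteq> y" and \<epsilon>: "\<epsilon> > 0"
    and close: "taylor_close d (Suc n) \<epsilon> (av (x - y)) x y"
    and rec: "\<And>i m. i + m \<le> n \<Longrightarrow> (x - y) * A (Suc i) (Suc m) = A (Suc i) m - A i (Suc m)"
    and A0: "\<And>m. m \<le> n \<Longrightarrow> A 0 (Suc m) = d m y"
    and A1: "\<And>i. i \<le> n \<Longrightarrow> A (Suc i) 0 = d i x"
    and im: "i + m = n"
  shows "av (A (Suc i) (Suc m) - d (Suc n) y) < \<epsilon>"
proof -
  let ?N = "Suc n"
  let ?Z = "\<lambda>i m. A i m - poly_dd d ?N x y i m"
  have \<rho>: "av (x - y) > 0" using xy by simp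
  have Zrec: "(x - y) * ?Z (Suc i) (Suc m) = ?Z (Suc i) m - ?Z i (Suc m)" if "i + m \<le> n" for i m
    using that by (simp only: right_diff_distrib rec poly_dd_rec) simp
  have step: "av (?Z (Suc i) (Suc m)) < \<epsilon> * av (x - y) ^ (?N - i - Suc m)"
    if "i + m \<le> n" "av ((x - y) * ?Z (Suc i) (Suc m)) < \<epsilon> * av (x - y) ^ (?N - i - m)" for i m
  proof -
    have "?N - i - m = Suc (?N - i - Suc m)" using that(1) by simp
    then have "av (x - y) * av (?Z (Suc i) (Suc m)) < av (x - y) * (\<epsilon> * av (x - y) ^ (?N - i - Suc m))"
      using that(2) by (simp only: av_mult power_Suc mult.left_commute)
    then show ?thesis using \<rho> by (simp only: mult_less_cancel_left_pos)
  qed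
  \<comment> \<open>The recursion refers to one entry with fewer copies of \<open>y\<close> and one
    with fewer copies of \<open>x\<close>, hence an outer induction on \<open>m\<close> and an inner
    one on \<open>i\<close>.\<close>
  have bound: "av (?Z (Suc i) m) < \<epsilon> * av (x - y) ^ (?N - i - m)" if "i \<le> n" "i + m \<le> ?N" for i m
    using that
  proof (induction m arbitrary: i)
    case 0
    then have "?Z (Suc i) 0 = taylor_rem d ?N i x y" by (simp only: A1 poly_dd.simps taylor_rem_def) simp
    then show ?case using close 0 by (simp add: taylor_close_def)
  next
    case (Suc m)
    note IHm = Suc.IH
    from Suc.prems show ?case
    proof (induction i)
      case 0
      have "?Z 0 (Suc m) = 0" using 0 by (simp only: A0 poly_dd.simps) simp
      then have "(x - y) * ?Z (Suc 0) (Suc m) = ?Z (Suc 0) m" using Zrec[of 0 m] 0 by simp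
      then have "av ((x - y) * ?Z (Suc 0) (Suc m)) < \<epsilon> * av (x - y) ^ (?N - 0 - m)"
        using IHm[of 0] 0 by (simp only:)
      moreover have "0 + m \<le> n" using 0 by simp
      ultimately show ?case by (rule step[rotated])
    next
      case (Suc i)
      have "av (?Z (Suc (Suc i)) m) < \<epsilon> * av (x - y) ^ (?N - Suc i - m)"
        using Suc.prems by (intro IHm) auto
      moreover have "av (?Z (Suc i) (Suc m)) < \<epsilon> * av (x - y) ^ (?N - i - Suc m)"
        using Suc.prems by (intro Suc.IH) auto
      then have "av (?Z (Suc i) (Suc m)) < \<epsilon> * av (x - y) ^ (?N - Suc i - m)" by simp
      ultimately have diff: "av (?Z (Suc (Suc i)) m - ?Z (Suc i) (Suc m)) < \<epsilon> * av (x - y) ^ (?N - Suc i - m)"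
        by (rule av_diff_less)
      have le: "Suc i + m \<le> n" using Suc.prems by simp
      show ?case by (rule step[OF le], unfold Zrec[OF le], rule diff)
    qed
  qed
  have "poly_dd d ?N x y (Suc i) (Suc m) = d ?N y" using im by (intro poly_dd_top) simp
  with bound[of i "Suc m"] im show ?thesis by simp
qed

section \<open>Digit expansions\<close>

context
  fixes \<pi> :: 'a and T :: "'a set"
  assumes unif: "uniformizer v \<pi>" and reps: "residue_representatives v T" and zero_T: "0 \<in> T"
begin

lemma av_\<pi>_pos: "av \<pi> > 0" and av_\<pi>_less_1: "av \<pi> < 1" and \<pi>_nonzero: "\<pi> \<noteq> 0"
  using unif q_gt_1 by (simp_all add: av_uniformizer[OF unif] inverse_less_1_iff uniformizer_def)

lemma T_in_R: "t \<in> T \<Longrightarrow> t \<in> R"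
  using reps by (auto simp: residue_representatives_def)

lemma ex_representative:
  assumes "w \<in> R"
  shows "\<exists>t\<in>T. av (w - t) \<le> av \<pi>"
proof -
  let ?r = "{(x, y). x \<in> R \<and> y \<in> R \<and> x - y \<in> max_ideal v}"
  have "?r `` {w} \<in> residue_field v"
    unfolding residue_field_def using assms by (rule quotientI)
  then obtain t where "t \<in> T" "t \<in> ?r `` {w}"
    using reps unfolding residue_representatives_def by blast
  then have "av (w - t) < 1" by (simp add: in_max_ideal_iff)
  then show ?thesis
    using \<open>t \<in> T\<close> unfolding av_less_one_iff av_uniformizer[OF unif] by blast
qed

text \<open>Digits at distance less than 1 share a residue class, and each class contains a single
  representative.\<close>

lemma av_diff_representatives:
  assumes "s \<in> T" "t \<in> T" "s \<noteq> t"
  shows "av (s - t) = 1"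
proof (rule ccontr)
  let ?r = "{(x, y). x \<in> R \<and> y \<in> R \<and> x - y \<in> max_ideal v}"
  assume "av (s - t) \<noteq> 1"
  moreover have "av (s - t) \<le> 1"
    using R_diff[OF T_in_R T_in_R] assms by (simp add: in_R_iff)
  ultimately have t: "t \<in> ?r `` {s}" using assms T_in_R by (simp add: in_max_ideal_iff)
  have s: "s \<in> ?r `` {s}" using assms T_in_R by (simp add: in_max_ideal_iff)
  have "?r `` {s} \<in> residue_field v"
    unfolding residue_field_def using T_in_R[OF assms(1)] by (rule quotientI)
  then have uniq: "\<exists>!t. t \<in> T \<and> t \<in> ?r `` {s}"
    using reps unfolding residue_representatives_def by (elim conjE bspec)
  have "s = t" if "\<exists>!t. t \<in> T \<and> t \<in> X" "s \<in> X" "t \<in> X" for X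
    using that assms(1,2) by blast
  from this[OF uniq s t] assms(3) show False by contradiction
qed

lemma partial_expansion_in_R:
  assumes "range a \<subseteq> T" shows "partial_expansion \<pi> a k \<in> R"
proof (induction k)
  case (Suc k)
  have "\<pi> \<in> R" using av_\<pi>_less_1 by (simp add: in_R_iff)
  then show ?case
    unfolding partial_expansion_Suc
    by (rule R_add[OF Suc.IH R_mult[OF T_in_R[OF range_subsetD[OF assms]] R_power]])
qed (simp add: partial_expansion_def)

lemma av_partial_expansion_tail:
  assumes "range a \<subseteq> T" "k \<le> M"
  shows "av (partial_expansion \<pi> a M - partial_expansion \<pi> a k) \<le> av \<pi> ^ k"
  using assms(2)
proof (induction M rule: dec_induct)
  case (step M)
  have "av (a M * \<pi> ^ M) \<le> 1 * av \<pi> ^ k"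
    unfolding av_mult av_power using step.hyps av_\<pi>_pos av_\<pi>_less_1 T_in_R[OF range_subsetD[OF assms(1), of M]]
    by (intro mult_mono power_decreasing) (auto simp: in_R_iff)
  moreover have "partial_expansion \<pi> a (Suc M) - partial_expansion \<pi> a k =
    (partial_expansion \<pi> a M - partial_expansion \<pi> a k) + a M * \<pi> ^ M"
    by (simp add: partial_expansion_Suc)
  ultimately show ?case using step.IH by (metis av_add_le mult_1)
qed (use av_\<pi>_pos in simp)

text \<open>The first differing digit contributes exactly \<open>av \<pi> ^ m\<close>, and the later
  digits at most \<open>av \<pi> ^ Suc m\<close>, so it dominates.\<close>

lemma av_partial_expansion_diff:
  assumes a: "range a \<subseteq> T" and b: "range b \<subseteq> T"
    and eq: "\<And>i. i < m \<Longrightarrow> a i = b i" and ne: "a m \<noteq> b m" and M: "m < M"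
  shows "av (partial_expansion \<pi> a M - partial_expansion \<pi> b M) = av \<pi> ^ m"
proof -
  let ?x = "partial_expansion \<pi> a M - partial_expansion \<pi> b M" and ?y = "(a m - b m) * \<pi> ^ m"
  have y: "av ?y = av \<pi> ^ m"
    by (simp add: av_mult av_power av_diff_representatives[OF range_subsetD[OF a] range_subsetD[OF b] ne])
  have "?x - ?y = (partial_expansion \<pi> a M - partial_expansion \<pi> a (Suc m)) -
      (partial_expansion \<pi> b M - partial_expansion \<pi> b (Suc m))"
    using partial_expansion_cong[of m a b \<pi>] eq by (simp add: partial_expansion_Suc algebra_simps)
  then have "av (?x - ?y) \<le> av \<pi> ^ Suc m"
    using M by (simp only:) (intro av_diff_le av_partial_expansion_tail a b, auto)
  also have "\<dots> < av ?y"
    unfolding y using av_\<pi>_pos av_\<pi>_less_1 by simp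
  finally show ?thesis using av_eq_of_diff_less y by metis
qed

lemma partial_expansion_inj:
  assumes a: "range a \<subseteq> T" and b: "range b \<subseteq> T"
    and eq: "partial_expansion \<pi> a M = partial_expansion \<pi> b M" and i: "i < M"
  shows "a i = b i"
proof (rule ccontr)
  assume "a i \<noteq> b i"
  define m where "m = (LEAST i. a i \<noteq> b i)"
  have ne: "a m \<noteq> b m" unfolding m_def by (rule LeastI) fact
  have less: "a i = b i" if "i < m" for i using not_less_Least that unfolding m_def by blast
  have "m \<le> i" unfolding m_def by (rule Least_le) fact
  then have "av (partial_expansion \<pi> a M - partial_expansion \<pi> b M) = av \<pi> ^ m"
    using i by (intro av_partial_expansion_diff a b less ne) auto
  then show False using eq av_\<pi>_pos by simp
qed

lemma partial_expansion_nonzero: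
  assumes a: "range a \<subseteq> T" and ne: "a k \<noteq> 0"
  shows "partial_expansion \<pi> a (Suc k) \<noteq> 0"
proof
  assume "partial_expansion \<pi> a (Suc k) = 0"
  then have "partial_expansion \<pi> a (Suc k) = partial_expansion \<pi> (\<lambda>_. 0) (Suc k)"
    by (simp add: partial_expansion_def)
  from partial_expansion_inj[OF a _ this, of k] zero_T ne show False by auto
qed

lemma drop_leading_partial_expansion:
  assumes a: "range a \<subseteq> T" and ne: "a k \<noteq> 0"
  shows "drop_leading \<pi> T (partial_expansion \<pi> a (Suc k)) = partial_expansion \<pi> a k"
  unfolding drop_leading_def
proof (rule the_equality)
  show "\<exists>m b. (\<forall>i\<le>m. b i \<in> T) \<and> b m \<noteq> 0 \<and>
    partial_expansion \<pi> a (Suc k) = (\<Sum>i\<le>m. b i * \<pi> ^ i) \<and> partial_expansion \<pi> a k = (\<Sum>i<m. b i * \<pi> ^ i)"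
    using range_subsetD[OF a] ne
    by (intro exI[of _ k] exI[of _ a]) (auto simp: partial_expansion_def lessThan_Suc_atMost)
next
  fix s assume "\<exists>m b. (\<forall>i\<le>m. b i \<in> T) \<and> b m \<noteq> 0 \<and>
    partial_expansion \<pi> a (Suc k) = (\<Sum>i\<le>m. b i * \<pi> ^ i) \<and> s = (\<Sum>i<m. b i * \<pi> ^ i)"
  then obtain m b where b: "\<And>i. i \<le> m \<Longrightarrow> b i \<in> T" "b m \<noteq> 0"
    and eq: "partial_expansion \<pi> a (Suc k) = partial_expansion \<pi> b (Suc m)"
    and s: "s = partial_expansion \<pi> b m"
    by (auto simp: partial_expansion_def lessThan_Suc_atMost)
  \<comment> \<open>Padding with zero digits brings expansions of different lengths to the common
    length \<open>M\<close>, where digits are unique; \<open>0 \<in> T\<close> keeps the padded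
    digits admissible.\<close>
  define cut where "cut c l i = (if i \<le> l then c i else 0)" for c :: "nat \<Rightarrow> 'a" and l i :: nat
  define M where "M = Suc (max k m)"
  have cut: "partial_expansion \<pi> (cut c l) M = partial_expansion \<pi> c (Suc l)" if "Suc l \<le> M" for c l
    unfolding partial_expansion_def
    by (rule sum.mono_neutral_cong_right) (use that in \<open>auto simp: cut_def\<close>)
  have "partial_expansion \<pi> (cut a k) M = partial_expansion \<pi> (cut b m) M"
    by (subst (1 2) cut) (auto simp: M_def eq)
  then have ab: "cut a k i = cut b m i" if "i < M" for i
    by (rule partial_expansion_inj[rotated 2, OF _ that])
      (use range_subsetD[OF a] b zero_T in \<open>auto simp: cut_def\<close>)
  \<comment> \<open>A nonzero leading digit of one expansion cannot match a padding zero of the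
    other.\<close>
  have "m = k"
    using ab[of k] ab[of m] ne b(2) by (auto simp: cut_def M_def split: if_splits)
  moreover have "a i = b i" if "i \<le> k" for i
    using ab[of i] that \<open>m = k\<close> by (simp add: cut_def M_def)
  ultimately show "s = partial_expansion \<pi> a k"
    unfolding s by (metis partial_expansion_cong less_imp_le)
qed

lemma partial_expansion_in_all_finite_expansions:
  assumes "range a \<subseteq> T"
  shows "partial_expansion \<pi> a (Suc k) \<in> all_finite_expansions \<pi> T"
  unfolding all_finite_expansions_def finite_expansions_def partial_expansion_def
  using range_subsetD[OF assms] by (intro UN_I[of "Suc k"] CollectI exI[of _ a]) auto

text \<open>The next digit represents the residue of the error divided by \<open>\<pi> ^ M\<close>.
  The digits may depend on the precision \<open>M\<close>, which suffices for approximating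
  \<open>x\<close> by finite expansions.\<close>

lemma ex_expansion:
  assumes x: "x \<in> R"
  shows "\<exists>a. range a \<subseteq> T \<and> av (x - partial_expansion \<pi> a M) \<le> av \<pi> ^ M"
proof (induction M)
  case 0
  then show ?case
    using x zero_T by (intro exI[of _ "\<lambda>_. 0"]) (auto simp: in_R_iff partial_expansion_def)
next
  case (Suc M)
  then obtain a where a: "range a \<subseteq> T" "av (x - partial_expansion \<pi> a M) \<le> av \<pi> ^ M" by blast
  let ?w = "(x - partial_expansion \<pi> a M) / \<pi> ^ M"
  have "?w \<in> R" using a(2) av_\<pi>_pos by (simp add: in_R_iff av_divide av_power)
  then obtain t where t: "t \<in> T" "av (?w - t) \<le> av \<pi>" using ex_representative by blast
  let ?b = "a(M := t)"
  have "x - partial_expansion \<pi> ?b (Suc M) = (?w - t) * \<pi> ^ M"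
    using \<pi>_nonzero partial_expansion_cong[of M ?b a \<pi>] by (simp add: partial_expansion_Suc field_simps)
  then have "av (x - partial_expansion \<pi> ?b (Suc M)) = av (?w - t) * av \<pi> ^ M"
    by (simp only: av_mult av_power)
  also have "\<dots> \<le> av \<pi> * av \<pi> ^ M" using t(2) av_\<pi>_pos by (intro mult_right_mono) auto
  finally have "av (x - partial_expansion \<pi> ?b (Suc M)) \<le> av \<pi> ^ Suc M" by simp
  moreover have "range ?b \<subseteq> T" using a(1) t(1) by auto
  ultimately show ?case by blast
qed

section \<open>Chaining closeness along digit expansions\<close>

context
  fixes d :: "nat \<Rightarrow> 'a \<Rightarrow> 'a" and N :: nat and \<epsilon> \<delta> :: real and c0 :: 'a
  assumes eps: "\<epsilon> > 0"
    and close_step: "\<And>a k. \<lbrakk>range a \<subseteq> T; a k \<noteq> 0; av (partial_expansion \<pi> a (Suc k) - c0) < \<delta>;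
      av (partial_expansion \<pi> a k - c0) < \<delta>\<rbrakk> \<Longrightarrow>
      taylor_close d N \<epsilon> (av \<pi> ^ k) (partial_expansion \<pi> a (Suc k)) (partial_expansion \<pi> a k)"
begin

text \<open>Neighbouring truncations are linked one digit at a time. Those of length between
  \<open>m\<close> and \<open>M\<close> stay in the ball, because the omitted tail is at most
  \<open>av \<pi> ^ m\<close>; a zero digit does not move the point; and closeness at the finer
  scale \<open>av \<pi> ^ k\<close> weakens to scale \<open>av \<pi> ^ m\<close>.\<close>

lemma taylor_close_truncation:
  assumes a: "range a \<subseteq> T" and M: "m \<le> M"
    and ball: "av (partial_expansion \<pi> a M - c0) < \<delta>" "av \<pi> ^ m < \<delta>"
  shows "taylor_close d N \<epsilon> (av \<pi> ^ m) (partial_expansion \<pi> a M) (partial_expansion \<pi> a m)"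
proof -
  have \<rho>: "av \<pi> ^ m > 0" using av_\<pi>_pos by simp
  have decr: "av \<pi> ^ k \<le> av \<pi> ^ m" if "m \<le> k" for k
    using that av_\<pi>_pos av_\<pi>_less_1 by (intro power_decreasing) auto
  have in_ball: "av (partial_expansion \<pi> a k - c0) < \<delta>" if "m \<le> k" "k \<le> M" for k
  proof -
    have "av (partial_expansion \<pi> a M - partial_expansion \<pi> a k) \<le> av \<pi> ^ k"
      by (rule av_partial_expansion_tail[OF a that(2)])
    also have "\<dots> < \<delta>" using decr[OF that(1)] ball(2) by simp
    finally have "av ((partial_expansion \<pi> a M - c0) - (partial_expansion \<pi> a M - partial_expansion \<pi> a k)) < \<delta>"
      by (rule av_diff_less[OF ball(1)])
    then show ?thesis by simp
  qed
  have "k \<le> M \<longrightarrow> taylor_close d N \<epsilon> (av \<pi> ^ m) (partial_expansion \<pi> a k) (partial_expansion \<pi> a m)"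
    if "m \<le> k" for k
    using that
  proof (induction k rule: dec_induct)
    case base
    show ?case using taylor_close_refl[OF eps \<rho>] by simp
  next
    case (step k)
    show ?case
    proof
      assume k: "Suc k \<le> M"
      have "av (partial_expansion \<pi> a (Suc k) - partial_expansion \<pi> a k) \<le> av \<pi> ^ k"
        by (rule av_partial_expansion_tail[OF a]) simp
      then have le: "av (partial_expansion \<pi> a (Suc k) - partial_expansion \<pi> a k) \<le> av \<pi> ^ m"
        using decr[OF step.hyps(1)] by simp
      have "taylor_close d N \<epsilon> (av \<pi> ^ m) (partial_expansion \<pi> a (Suc k)) (partial_expansion \<pi> a k)"
      proof (cases "a k = 0")
        case True
        then show ?thesis using taylor_close_refl[OF eps \<rho>] by (simp add: partial_expansion_Suc)
      next
        case False
        have "taylor_close d N \<epsilon> (av \<pi> ^ k) (partial_expansion \<pi> a (Suc k)) (partial_expansion \<pi> a k)"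
          using k step.hyps by (intro close_step a False in_ball) auto
        then show ?thesis
          by (rule taylor_close_mono[OF _ _ decr[OF step.hyps(1)] eps]) simp
      qed
      then show "taylor_close d N \<epsilon> (av \<pi> ^ m) (partial_expansion \<pi> a (Suc k)) (partial_expansion \<pi> a m)"
        by (rule taylor_close_trans[OF _ _ le eps \<rho>]) (use step.IH k in simp)
    qed
  qed
  then show ?thesis using M by blast
qed

text \<open>Both points are compared with their common truncation just before the first differing
  digit \<open>m\<close>; the matching scale is \<open>av \<pi> ^ m\<close>, which equals
  \<open>av (x - y)\<close>.\<close>

lemma taylor_close_expansions:
  assumes a: "range a \<subseteq> T" and b: "range b \<subseteq> T"
    and x: "x = partial_expansion \<pi> a M" and y: "y = partial_expansion \<pi> b M" and xy: "x \<noteq> y"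
    and ball: "av (x - c0) < \<delta>" "av (y - c0) < \<delta>"
  shows "taylor_close d N \<epsilon> (av (x - y)) x y"
proof -
  define m where "m = (LEAST i. a i \<noteq> b i)"
  have "\<exists>i<M. a i \<noteq> b i" using xy unfolding x y by (metis partial_expansion_cong)
  then obtain i where i: "i < M" "a i \<noteq> b i" by blast
  have ne: "a m \<noteq> b m" unfolding m_def by (rule LeastI) (rule i)
  have less: "a i = b i" if "i < m" for i using not_less_Least that unfolding m_def by blast
  have m: "m < M" using i(1) Least_le[of "\<lambda>i. a i \<noteq> b i", OF i(2)] by (simp add: m_def)
  have \<rho>: "av (x - y) = av \<pi> ^ m"
    unfolding x y by (intro av_partial_expansion_diff a b less ne m)
  \<comment> \<open>Two points of an ultrametric ball are at distance less than its radius.\<close>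
  have "av ((x - c0) - (y - c0)) < \<delta>" by (intro av_diff_less ball)
  then have \<delta>: "av \<pi> ^ m < \<delta>" using \<rho> by simp
  have pos: "av \<pi> ^ m > 0" using av_\<pi>_pos by simp
  have s: "partial_expansion \<pi> a m = partial_expansion \<pi> b m"
    by (rule partial_expansion_cong) (rule less)
  have xs: "taylor_close d N \<epsilon> (av \<pi> ^ m) x (partial_expansion \<pi> a m)"
    unfolding x using m ball(1) by (intro taylor_close_truncation a \<delta>) (auto simp: x)
  have ys: "taylor_close d N \<epsilon> (av \<pi> ^ m) y (partial_expansion \<pi> a m)"
    unfolding y s using m ball(2) by (intro taylor_close_truncation b \<delta>) (auto simp: y)
  have "av (y - partial_expansion \<pi> a m) \<le> av \<pi> ^ m" "av (x - partial_expansion \<pi> a m) \<le> av \<pi> ^ m"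
    using av_partial_expansion_tail[OF a, of m M] av_partial_expansion_tail[OF b, of m M] m
    by (simp_all add: x y s)
  with xs ys show ?thesis
    unfolding \<rho> by (meson taylor_close_trans taylor_close_sym eps pos)
qed

text \<open>Approximate by finite expansions. The strict bound survives the limit for ultrametric
  reasons: the approximating pairs eventually have exactly the distance \<open>av (x - y)\<close>,
  and their remainders differ from the limit by less than the bound itself.\<close>

lemma taylor_close_all:
  assumes dlim: "\<And>l u x. \<lbrakk>l \<le> N; u \<longlonglongrightarrow> x; \<And>M. u M \<in> R; x \<in> R\<rbrakk> \<Longrightarrow> (\<lambda>M. d l (u M)) \<longlonglongrightarrow> d l x"
    and x: "x \<in> R" and y: "y \<in> R" and xy: "x \<noteq> y"
    and ball: "av (x - c0) < \<delta>" "av (y - c0) < \<delta>"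
  shows "taylor_close d N \<epsilon> (av (x - y)) x y"
proof -
  have approx: "\<exists>A. (\<forall>M. range (A M) \<subseteq> T) \<and> (\<lambda>M. partial_expansion \<pi> (A M) M) \<longlonglongrightarrow> x" if x: "x \<in> R" for x
  proof -
    obtain A where A: "\<And>M. range (A M) \<subseteq> T" "\<And>M. av (x - partial_expansion \<pi> (A M) M) \<le> av \<pi> ^ M"
      using ex_expansion[OF x] by metis
    have lim: "(\<lambda>M. av \<pi> ^ M) \<longlonglongrightarrow> 0"
      using av_\<pi>_pos av_\<pi>_less_1 by (intro LIMSEQ_realpow_zero) auto
    have le: "av (partial_expansion \<pi> (A M) M - x) \<le> av \<pi> ^ M" for M
      using A(2)[of M] by (subst av_diff_commute)
    have "(\<lambda>M. av (partial_expansion \<pi> (A M) M - x)) \<longlonglongrightarrow> 0"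
      by (rule tendsto_sandwich[OF _ _ tendsto_const lim]) (simp_all add: le)
    then have "(\<lambda>M. partial_expansion \<pi> (A M) M) \<longlonglongrightarrow> x"
      by (subst tendsto_av_iff)
    with A(1) show ?thesis by blast
  qed
  obtain A where A: "\<And>M. range (A M) \<subseteq> T" and Ax: "(\<lambda>M. partial_expansion \<pi> (A M) M) \<longlonglongrightarrow> x"
    using approx[OF x] by blast
  obtain B where B: "\<And>M. range (B M) \<subseteq> T" and By: "(\<lambda>M. partial_expansion \<pi> (B M) M) \<longlonglongrightarrow> y"
    using approx[OF y] by blast
  define X where "X M = partial_expansion \<pi> (A M) M" for M
  define Y where "Y M = partial_expansion \<pi> (B M) M" for M
  have X: "X \<longlonglongrightarrow> x" "\<And>M. X M \<in> R" and Y: "Y \<longlonglongrightarrow> y" "\<And>M. Y M \<in> R"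
    using Ax By partial_expansion_in_R A B by (auto simp: X_def[abs_def] Y_def[abs_def])
  have av_lim: "\<forall>\<^sub>F M in sequentially. av (u M - l) < r" if "u \<longlonglongrightarrow> l" "r > 0" for u l r
    using tendstoD[OF that] by (simp add: dist_eq_absv)
  have eventually_ball: "\<forall>\<^sub>F M in sequentially. av (u M - c0) < \<delta>" if "u \<longlonglongrightarrow> z" "av (z - c0) < \<delta>" for u z
    using order_tendstoD(2)[OF tendsto_lf_av[OF tendsto_lf_diff[OF that(1) tendsto_const]] that(2)] .
  have XY: "\<forall>\<^sub>F M in sequentially. av (X M - Y M) = av (x - y)"
    using av_lim[OF tendsto_lf_diff[OF X(1) Y(1)], of "av (x - y)"] xy
    by (auto elim!: eventually_mono intro: av_eq_of_diff_less)
  have close: "\<forall>\<^sub>F M in sequentially. taylor_close d N \<epsilon> (av (x - y)) (X M) (Y M)"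
    using XY eventually_ball[OF X(1) ball(1)] eventually_ball[OF Y(1) ball(2)]
  proof eventually_elim
    case (elim M)
    have "X M \<noteq> Y M" using elim(1) xy by auto
    then have "taylor_close d N \<epsilon> (av (X M - Y M)) (X M) (Y M)"
      using elim by (intro taylor_close_expansions[OF A B X_def Y_def])
    then show ?case using elim(1) by simp
  qed
  show ?thesis
    unfolding taylor_close_def
  proof (intro allI impI)
    fix j assume j: "j \<le> N"
    have pos: "\<epsilon> * av (x - y) ^ (N - j) > 0" using eps xy by simp
    have "(\<lambda>M. taylor_rem d N j (X M) (Y M)) \<longlonglongrightarrow> taylor_rem d N j x y"
      unfolding taylor_rem_def
      by (intro tendsto_lf_diff tendsto_lf_sum tendsto_lf_mult tendsto_lf_power tendsto_const dlim X Y x y j)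
        auto
    from eventually_conj[OF av_lim[OF this pos] close]
    obtain M where M: "av (taylor_rem d N j (X M) (Y M) - taylor_rem d N j x y) < \<epsilon> * av (x - y) ^ (N - j)"
      "taylor_close d N \<epsilon> (av (x - y)) (X M) (Y M)"
      using eventually_happens'[OF sequentially_bot] by blast
    have "av (taylor_rem d N j (X M) (Y M)) < \<epsilon> * av (x - y) ^ (N - j)"
      using M(2) j by (simp add: taylor_close_def)
    then have "av (taylor_rem d N j (X M) (Y M) - (taylor_rem d N j (X M) (Y M) - taylor_rem d N j x y))
      < \<epsilon> * av (x - y) ^ (N - j)"
      by (rule av_diff_less[OF _ M(1)])
    then show "av (taylor_rem d N j x y) < \<epsilon> * av (x - y) ^ (N - j)" by simp
  qed
qed

end

end

text \<open>By \<open>D_D\<close>, the terms \<open>D v l (D v j f) y\<close> in \<open>psi\<close>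
  are those of the Taylor polynomial at \<open>y\<close>, with index shifted by \<open>j\<close>.
  The constant top coefficient supplies the multiple of \<open>c\<close>. The value of
  \<open>psi\<close> at index 0 fits in as the case of an empty sum.\<close>

lemma taylor_rem_D_eq:
  fixes f :: "'a \<Rightarrow> 'a" and c :: 'a and n :: nat
  defines "d \<equiv> \<lambda>l. if l \<le> n then D v l f else (\<lambda>_. c)"
  assumes f: "f \<in> C_k v n" and j: "j \<le> n" and y: "y \<in> R" and xy: "x \<noteq> y"
  shows "taylor_rem d (Suc n) j x y =
    (x - y) ^ (Suc n - j) * (psi v (n - j) (D v j f) x y - of_nat (Suc n choose j) * c)"
proof -
  have exp: "Suc n - j = Suc (n - j)" using j by simp
  have psi: "(x - y) ^ (Suc n - j) * psi v (n - j) (D v j f) x y =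
    D v j f x - D v j f y - (\<Sum>l=1..n - j. (x - y) ^ l * D v l (D v j f) y)"
    using xy by (cases "n - j = 0") (simp_all add: psi_def exp)
  have "(\<Sum>l\<le>n. of_nat (l choose j) * (x - y) ^ (l - j) * d l y) =
    (\<Sum>l\<in>{j..n}. of_nat (l choose j) * (x - y) ^ (l - j) * d l y)"
    by (intro sum.mono_neutral_right) (auto simp: binomial_eq_0 not_le)
  also have "\<dots> = (\<Sum>l\<in>{0..n - j}. (x - y) ^ l * (of_nat ((l + j) choose j) * D v (l + j) f y))"
    by (rule sum.reindex_bij_witness[of _ "\<lambda>l. l + j" "\<lambda>l. l - j"])
      (use j in \<open>auto simp: d_def mult_ac\<close>)
  also have "\<dots> = (\<Sum>l\<in>{0..n - j}. (x - y) ^ l * D v l (D v j f) y)"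
    using j by (intro sum.cong refl) (simp add: D_D[OF f _ y])
  also have "\<dots> = D v 0 (D v j f) y + (\<Sum>l=1..n - j. (x - y) ^ l * D v l (D v j f) y)"
    by (simp add: sum.atLeast_Suc_atMost)
  also have "D v 0 (D v j f) y = D v j f y"
    using D_D[OF f, of 0 j y] j y by simp
  finally have "taylor_rem d (Suc n) j x y = D v j f x -
    (D v j f y + (\<Sum>l=1..n - j. (x - y) ^ l * D v l (D v j f) y)) - of_nat (Suc n choose j) * (x - y) ^ (Suc n - j) * c"
    using j by (simp add: taylor_rem_def d_def del: binomial_Suc_Suc)
  then show ?thesis
    unfolding right_diff_distrib psi by (simp add: mult_ac del: binomial_Suc_Suc)
qed

lemma psi2_bound:
  fixes f :: "'a \<Rightarrow> 'a" and c :: 'a and n :: nat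
  defines "d \<equiv> \<lambda>l. if l \<le> n then D v l f else (\<lambda>_. c)"
  assumes f: "f \<in> C_k v n" and x: "x \<in> R" and y: "y \<in> R" and xy: "x \<noteq> y" and \<epsilon>: "\<epsilon> > 0"
    and close: "taylor_close d (Suc n) \<epsilon> (av (x - y)) x y" and j: "1 \<le> j" "j \<le> n + 1"
  shows "av (psi2 v n j f x y - c) < \<epsilon>"
proof -
  \<comment> \<open>Lists of at most \<open>n + 1\<close> entries are handled by \<open>dd\<close>;
    those of \<open>n + 2\<close> entries need the extension off the diagonal, and the recursion
    reaches them only with both \<open>x\<close> and \<open>y\<close> present.\<close>
  define A where "A i m = (if i + m \<le> Suc n then dd f (replicate i x @ replicate m y) else psi2 v n i f x y)"
    for i m
  have rec: "(x - y) * A (Suc i) (Suc m) = A (Suc i) m - A i (Suc m)" if im: "i + m \<le> n" for i m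
  proof (cases "i + m = n")
    case True
    then show ?thesis using psi2_eq[OF f x y xy True] by (simp add: A_def)
  next
    case False
    let ?zs = "replicate i x @ replicate m y"
    have "dd f (x # ?zs) - dd f (y # ?zs) = (x - y) * dd f (x # y # ?zs)"
      using im False x y by (intro dd_rec[OF f]) auto
    moreover have "dd f (replicate i x @ replicate (Suc m) y) = dd f (y # ?zs)"
      using im x y by (intro dd_mset[OF f]) auto
    moreover have "dd f (replicate (Suc i) x @ replicate (Suc m) y) = dd f (x # y # ?zs)"
      using im False x y by (intro dd_mset[OF f]) auto
    ultimately show ?thesis using im False by (simp add: A_def)
  qed
  obtain i where i: "j = Suc i" using j by (cases j) auto
  have "av (A (Suc i) (Suc (n - i)) - d (Suc n) y) < \<epsilon>"
  proof (rule divided_difference_bound[where A = A, OF xy \<epsilon> close])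
    show "(x - y) * A (Suc i) (Suc m) = A (Suc i) m - A i (Suc m)" if "i + m \<le> n" for i m
      by (rule rec[OF that])
    show "A 0 (Suc m) = d m y" if "m \<le> n" for m
      using that by (simp add: A_def d_def D_eq_dd)
    show "A (Suc i) 0 = d i x" if "i \<le> n" for i
      using that by (simp add: A_def d_def D_eq_dd)
  qed (use j i in auto)
  moreover have "A (Suc i) (Suc (n - i)) = psi2 v n j f x y" using i j by (simp add: A_def)
  ultimately show ?thesis by (simp add: d_def)
qed

end

section \<open>From finite expansions to all pairs of points\<close>

theorem theorem3p13:
  fixes v :: "'a::{field, metric_space} \<Rightarrow> int"
    and \<pi> a c :: 'a and T :: "'a set" and f :: "'a \<Rightarrow> 'a"
    and n :: nat and \<delta> \<epsilon> :: real
  assumes "local_field v"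
    and "uniformizer v \<pi>"
    and "residue_representatives v T" and "0 \<in> T"
    and "CHAR('a) > 0 \<Longrightarrow> n \<le> CHAR('a) - 1"
    and "f \<in> C_k v n"
    and "a \<in> val_ring v"
    and "\<delta> > 0" and "\<epsilon> > 0"
    and "\<And>j r. \<lbrakk>j \<le> n; r \<in> all_finite_expansions \<pi> T; r \<noteq> 0;
           absv v (r - a) < \<delta>; absv v (drop_leading \<pi> T r - a) < \<delta>\<rbrakk>
         \<Longrightarrow> absv v (psi v (n - j) (D v j f) r (drop_leading \<pi> T r)
                     - of_nat ((n + 1) choose j) * c) < \<epsilon>"
  shows "\<forall>j x y. 1 \<le> j \<and> j \<le> n + 1 \<and> x \<in> val_ring v \<and> y \<in> val_ring v \<and> x \<noteq> y \<and>
           absv v (x - a) < \<delta> \<and> absv v (y - a) < \<delta>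
         \<longrightarrow> absv v (psi2 v n j f x y - c) < \<epsilon>"
proof -
  interpret local_field v by fact
  note unif = \<open>uniformizer v \<pi>\<close> and reps = \<open>residue_representatives v T\<close> and zero = \<open>0 \<in> T\<close>
    and f = \<open>f \<in> C_k v n\<close> and eps = \<open>\<epsilon> > 0\<close>
  define d where "d = (\<lambda>l. if l \<le> n then D v l f else (\<lambda>_. c))"
  let ?p = "partial_expansion \<pi>"
  have step: "taylor_close d (Suc n) \<epsilon> (av \<pi> ^ k) (?p b (Suc k)) (?p b k)"
    if b: "range b \<subseteq> T" "b k \<noteq> 0" and ball: "av (?p b (Suc k) - a) < \<delta>" "av (?p b k - a) < \<delta>" for b k
    unfolding taylor_close_def
  proof (intro allI impI)
    fix j assume j: "j \<le> Suc n"
    let ?r = "?p b (Suc k)" and ?s = "?p b k"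
    have "?r - ?s = b k * \<pi> ^ k" by (simp add: partial_expansion_Suc)
    \<comment> \<open>The leading digit and 0 are distinct representatives, so that digit is a unit
      and the distance of the two truncations is exactly the scale used for closeness.\<close>
    then have av: "av (?r - ?s) = av \<pi> ^ k"
      using av_diff_representatives[OF unif reps zero range_subsetD[OF b(1)] zero b(2)] by (simp add: av_mult av_power)
    have pos: "av \<pi> > 0" using av_\<pi>_pos[OF unif reps zero] .
    show "av (taylor_rem d (Suc n) j ?r ?s) < \<epsilon> * (av \<pi> ^ k) ^ (Suc n - j)"
    proof (cases "j \<le> n")
      case True
      have ne: "?r \<noteq> ?s" using av pos by auto
      have drop: "drop_leading \<pi> T ?r = ?s" by (rule drop_leading_partial_expansion[OF unif reps zero b])
      have "av (psi v (n - j) (D v j f) ?r (drop_leading \<pi> T ?r) - of_nat ((n + 1) choose j) * c) < \<epsilon>"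
        using True ball drop partial_expansion_in_all_finite_expansions[OF unif reps zero b(1)]
          partial_expansion_nonzero[OF unif reps zero b]
        by (intro assms(10)) auto
      then have "av (?r - ?s) ^ (Suc n - j) * av (psi v (n - j) (D v j f) ?r ?s - of_nat (Suc n choose j) * c) <
        (av \<pi> ^ k) ^ (Suc n - j) * \<epsilon>"
        unfolding drop av using pos by (intro mult_strict_left_mono) auto
      then show ?thesis
        unfolding d_def taylor_rem_D_eq[OF f True partial_expansion_in_R[OF unif reps zero b(1)] ne]
        by (simp only: av_mult av_power mult.commute)
    next
      \<comment> \<open>For \<open>j = Suc n\<close> no hypothesis is available, but the remainder
        is a difference of two values of the constant \<open>c\<close>.\<close>
      case False
      then have "j = Suc n" using j by simp
      then show ?thesis using eps by (simp add: taylor_rem_top d_def)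
    qed
  qed
  have dlim: "(\<lambda>M. d l (u M)) \<longlonglongrightarrow> d l x" if "u \<longlonglongrightarrow> x" "\<And>M. u M \<in> R" "x \<in> R" for l u x
    using D_tendsto[OF f _ that(1,3,2), of l] by (simp add: d_def)
  show ?thesis
  proof (intro allI impI, elim conjE)
    fix j x y
    assume j: "1 \<le> j" "j \<le> n + 1" and R: "x \<in> R" "y \<in> R" and xy: "x \<noteq> y"
      and ball: "av (x - a) < \<delta>" "av (y - a) < \<delta>"
    have "taylor_close d (Suc n) \<epsilon> (av (x - y)) x y"
      by (rule taylor_close_all[OF unif reps zero eps step dlim R xy ball])
    then show "av (psi2 v n j f x y - c) < \<epsilon>"
      unfolding d_def by (intro psi2_bound[OF f R xy eps _ j])
  qed
qed

end
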